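(* Let $D$ be a period domain of polarized Hodge structures on $(V,Q)$ of odd weight $n>1$, with Hodge numbers $h^{n,0}=h^{n-1,1}=1$ and $4\nmid \dim_{\mathbb{Q}}V$. If $\varphi\in D$ is irreducible and CM, then, for the Hodge decomposition of $\mathfrak{g}_{\mathbb{C}}$ induced by $\varphi$, $$\left(\mathfrak{g}^{1,-1}\oplus\mathfrak{g}^{0,0}\oplus\mathfrak{g}^{-1,1}\right)\cap\mathfrak{g}_{\mathbb{Q}}\subseteq\mathfrak{g}^{0,0}.$$
   Context: $V$ is a finite-dimensional $\mathbb{Q}$-vector space with polarization form $Q$ (alternating, as the weight is odd); the period domain $D$ parametrizes Hodge structures on $V$ polarized by $Q$ with fixed weight and Hodge numbers $h^{p,q}=\dim_{\mathbb{C}} V^{p,q}$. $G=\{g\in \mathrm{Aut}(V)\mid Q(gu,gv)=Q(u,v)\ \forall u,v\in V\}$, with Lie algebra $\mathfrak{g}_{\mathbb{Q}}=\{X\in \mathrm{End}(V)\mid Q(Xu,v)+Q(u,Xv)=0\ \forall u,v\in V\}$ and $\mathfrak{g}_{\mathbb{C}}=\mathfrak{g}_{\mathbb{Q}}\otimes\mathbb{C}$. The point $\varphi$, with $V_{\mathbb{C}}=\bigoplus_{p+q=n} V^{p,q}$, induces on $\mathfrak{g}_{\mathbb{C}}$ a weight $0$ Hodge decomposition with $\mathfrak{g}^{l,-l}=\{X\in\mathfrak{g}_{\mathbb{C}}\mid X(V^{p,q})\subseteq V^{p+l,q-l}\ \forall p,q\}$. Regarding $\varphi$ as a real representation of $\mathbb{C}^*$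 on $V_{\mathbb{R}}$, the Mumford-Tate group $M_\varphi$ is the smallest $\mathbb{Q}$-algebraic group whose real points contain $\varphi(S^1)$; $\varphi$ is CM if $M_\varphi$ is abelian. $\varphi$ is irreducible if $V$ has no rational sub-Hodge structures other than $0$ and $V$. *)

theory Defs
  imports "HOL-Analysis.Analysis"
begin

text \<open>
  The rational vector space \<open>V\<close> is \<open>\<rat>\<^sup>n\<close>, i.e. \<^typ>\<open>rat ^ 'n\<close> for an arbitrary finite index type,
  and \<open>V\<^sub>\<complex> = V \<otimes> \<complex>\<close> is \<^typ>\<open>complex ^ 'n\<close>. Endomorphisms of \<open>V\<close> and \<open>V\<^sub>\<complex>\<close> are square matrices.
\<close>

definition complex_vec :: "rat ^ 'n \<Rightarrow> complex ^ 'n" where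
  "complex_vec v = (\<chi> i. of_rat (v $ i))"

definition complex_mat :: "rat ^ 'n ^ 'm \<Rightarrow> complex ^ 'n ^ 'm" where
  "complex_mat X = (\<chi> i j. of_rat (X $ i $ j))"

definition conj_vec :: "complex ^ 'n \<Rightarrow> complex ^ 'n" where
  "conj_vec v = (\<chi> i. cnj (v $ i))"

definition complex_subspace :: "(rat ^ 'n) set \<Rightarrow> (complex ^ 'n) set" where
  "complex_subspace W = vec.span (complex_vec ` W)"


subsection \<open>Polarized Hodge structures\<close>

definition symplectic_form :: "(rat ^ 'n \<Rightarrow> rat ^ 'n \<Rightarrow> rat) \<Rightarrow> bool" where
  "symplectic_form Q \<longleftrightarrow>
     (\<forall>u. Vector_Spaces.linear (*s) (*) (\<lambda>v. Q u v)) \<and>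
     (\<forall>v. Vector_Spaces.linear (*s) (*) (\<lambda>u. Q u v)) \<and>
     (\<forall>u. Q u u = 0) \<and>
     (\<forall>u. (\<forall>v. Q u v = 0) \<longrightarrow> u = 0)"

text \<open>The \<open>\<complex>\<close>-bilinear extension of \<open>Q\<close> to \<open>V\<^sub>\<complex>\<close>.\<close>

definition complex_form ::
  "(rat ^ 'n \<Rightarrow> rat ^ 'n \<Rightarrow> rat) \<Rightarrow> complex ^ 'n \<Rightarrow> complex ^ 'n \<Rightarrow> complex" where
  "complex_form Q u v = (\<Sum>i\<in>UNIV. \<Sum>j\<in>UNIV. u $ i * v $ j * of_rat (Q (axis i 1) (axis j 1)))"

text \<open>
  A Hodge structure is given by its Hodge decomposition: \<open>\<phi> p q\<close> is \<open>V\<^sup>p\<^sup>,\<^sup>q\<close>. The indices are integers,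
  but only \<open>p, q \<ge> 0\<close> with \<open>p + q = n\<close> may contribute; letting all other \<open>V\<^sup>p\<^sup>,\<^sup>q\<close> be zero makes
  \<open>V\<^sup>p\<^sup>+\<^sup>l\<^sup>,\<^sup>q\<^sup>-\<^sup>l\<close> meaningful for every \<open>l\<close>.
\<close>

type_synonym 'n hodge_decomp = "int \<Rightarrow> int \<Rightarrow> (complex ^ 'n) set"

definition hodge_structure :: "int \<Rightarrow> 'n::finite hodge_decomp \<Rightarrow> bool" where
  "hodge_structure n \<phi> \<longleftrightarrow>
     (\<forall>p q. vec.subspace (\<phi> p q)) \<and>
     (\<forall>p q. \<not> (0 \<le> p \<and> 0 \<le> q \<and> p + q = n) \<longrightarrow> \<phi> p q = {0}) \<and>
     (\<forall>v. \<exists>!w. (\<forall>p. w p \<in> \<phi> p (n - p)) \<and> v = (\<Sum>p=0..n. w p)) \<and>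
     (\<forall>p q. conj_vec ` \<phi> p q = \<phi> q p)"

text \<open>The two Hodge-Riemann bilinear relations, for a Hodge structure of weight \<open>n\<close>.\<close>

definition polarized_by ::
  "int \<Rightarrow> (rat ^ 'n \<Rightarrow> rat ^ 'n \<Rightarrow> rat) \<Rightarrow> 'n::finite hodge_decomp \<Rightarrow> bool" where
  "polarized_by n Q \<phi> \<longleftrightarrow>
     (\<forall>p q p' q'. p + q = n \<longrightarrow> p' + q' = n \<longrightarrow> p' \<noteq> q \<longrightarrow>
        (\<forall>u\<in>\<phi> p q. \<forall>v\<in>\<phi> p' q'. complex_form Q u v = 0)) \<and>
     (\<forall>p q. \<forall>v\<in>\<phi> p q. v \<noteq> 0 \<longrightarrow>
        \<i> powi (p - q) * complex_form Q v (conj_vec v) \<in> \<real> \<and>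
        Re (\<i> powi (p - q) * complex_form Q v (conj_vec v)) > 0)"

definition period_domain ::
  "int \<Rightarrow> (rat ^ 'n \<Rightarrow> rat ^ 'n \<Rightarrow> rat) \<Rightarrow> (int \<Rightarrow> int \<Rightarrow> nat) \<Rightarrow> 'n::finite hodge_decomp set" where
  "period_domain n Q h =
     {\<phi>. hodge_structure n \<phi> \<and> polarized_by n Q \<phi> \<and> (\<forall>p q. vec.dim (\<phi> p q) = h p q)}"

definition sub_hodge_structure :: "'n::finite hodge_decomp \<Rightarrow> (rat ^ 'n) set \<Rightarrow> bool" where
  "sub_hodge_structure \<phi> W \<longleftrightarrow>
     vec.subspace W \<and>
     complex_subspace W = vec.span (\<Union>p q. complex_subspace W \<inter> \<phi> p q)"

definition irreducible_hodge :: "'n::finite hodge_decomp \<Rightarrow> bool" where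
  "irreducible_hodge \<phi> \<longleftrightarrow> (\<forall>W. sub_hodge_structure \<phi> W \<longrightarrow> W = {0} \<or> W = UNIV)"


subsection \<open>The Mumford-Tate group\<close>

text \<open>
  \<open>z \<in> \<complex>\<^sup>*\<close> acts on \<open>V\<^sup>p\<^sup>,\<^sup>q\<close> as \<open>z\<^sup>p (cnj z)\<^sup>q\<close>; the resulting matrix is real.
\<close>

definition hodge_rep :: "'n::finite hodge_decomp \<Rightarrow> complex \<Rightarrow> complex ^ 'n ^ 'n" where
  "hodge_rep \<phi> z = (THE A. \<forall>p q. \<forall>v\<in>\<phi> p q. A *v v = (z powi p * cnj z powi q) *s v)"

text \<open>Polynomial functions with rational coefficients in the entries of a complex matrix.\<close>

inductive_set rat_polyfuns :: "(complex ^ 'n ^ 'n \<Rightarrow> complex) set" where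
  const: "(\<lambda>A. of_rat c) \<in> rat_polyfuns"
| entry: "(\<lambda>A. A $ i $ j) \<in> rat_polyfuns"
| add: "f \<in> rat_polyfuns \<Longrightarrow> g \<in> rat_polyfuns \<Longrightarrow> (\<lambda>A. f A + g A) \<in> rat_polyfuns"
| mult: "f \<in> rat_polyfuns \<Longrightarrow> g \<in> rat_polyfuns \<Longrightarrow> (\<lambda>A. f A * g A) \<in> rat_polyfuns"

text \<open>
  A \<open>\<rat>\<close>-algebraic subgroup of \<open>GL(V)\<close>, identified with its group of complex points: in
  characteristic 0 algebraic groups are reduced, so nothing is lost.
\<close>

definition rat_algebraic_group :: "(complex ^ 'n ^ 'n) set \<Rightarrow> bool" where
  "rat_algebraic_group H \<longleftrightarrow>
     (\<exists>P \<subseteq> rat_polyfuns. H = {A. invertible A \<and> (\<forall>f\<in>P. f A = 0)}) \<and>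
     mat 1 \<in> H \<and>
     (\<forall>A\<in>H. \<forall>B\<in>H. A ** B \<in> H) \<and>
     (\<forall>A\<in>H. matrix_inv A \<in> H)"

definition real_points :: "(complex ^ 'n ^ 'n) set \<Rightarrow> (complex ^ 'n ^ 'n) set" where
  "real_points H = {A \<in> H. \<forall>i j. A $ i $ j \<in> \<real>}"

definition mumford_tate :: "'n::finite hodge_decomp \<Rightarrow> (complex ^ 'n ^ 'n) set" where
  "mumford_tate \<phi> = \<Inter> {H. rat_algebraic_group H \<and> hodge_rep \<phi> ` sphere 0 1 \<subseteq> real_points H}"

definition is_CM :: "'n::finite hodge_decomp \<Rightarrow> bool" where
  "is_CM \<phi> \<longleftrightarrow> (\<forall>A\<in>mumford_tate \<phi>. \<forall>B\<in>mumford_tate \<phi>. A ** B = B ** A)"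


subsection \<open>The induced Hodge decomposition of the Lie algebra\<close>

definition lie_rat :: "(rat ^ 'n \<Rightarrow> rat ^ 'n \<Rightarrow> rat) \<Rightarrow> (rat ^ 'n ^ 'n) set" where
  "lie_rat Q = {X. \<forall>u v. Q (X *v u) v + Q u (X *v v) = 0}"

text \<open>\<open>\<gg>\<^sub>\<rat> \<otimes> \<complex>\<close> as the complex span of \<open>\<gg>\<^sub>\<rat>\<close> in the complex matrices.\<close>

definition lie_complex :: "(rat ^ 'n \<Rightarrow> rat ^ 'n \<Rightarrow> rat) \<Rightarrow> (complex ^ 'n ^ 'n) set" where
  "lie_complex Q =
     {X. \<exists>S c. finite S \<and> S \<subseteq> lie_rat Q \<and> X = (\<Sum>Y\<in>S. mat (c Y) ** complex_mat Y)}"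

text \<open>\<open>lie_hodge Q \<phi> l\<close> is \<open>\<gg>\<^sup>l\<^sup>,\<^sup>-\<^sup>l\<close>.\<close>

definition lie_hodge ::
  "(rat ^ 'n \<Rightarrow> rat ^ 'n \<Rightarrow> rat) \<Rightarrow> 'n::finite hodge_decomp \<Rightarrow> int \<Rightarrow> (complex ^ 'n ^ 'n) set" where
  "lie_hodge Q \<phi> l = {X \<in> lie_complex Q. \<forall>p q. (*v) X ` \<phi> p q \<subseteq> \<phi> (p + l) (q - l)}"


subsection \<open>The Hodge representation and the Mumford-Tate group are well defined\<close>

lemma hodge_decomp_unique:
  assumes "hodge_structure n \<phi>" "\<And>p. w p \<in> \<phi> p (n - p)" "\<And>p. w' p \<in> \<phi> p (n - p)"
    "(\<Sum>p=0..n. w p) = (\<Sum>p=0..n. w' p)"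
  shows "w = w'"
  using assms unfolding hodge_structure_def by metis

lemma hodge_rep_ex1:
  fixes \<phi> :: "'n::finite hodge_decomp"
  assumes H: "hodge_structure n \<phi>"
  shows "\<exists>!A. \<forall>p q. \<forall>v\<in>\<phi> p q. A *v v = (z powi p * cnj z powi q) *s v"
proof -
  have sub: "vec.subspace (\<phi> p q)" for p q using H by (auto simp: hodge_structure_def)
  have triv: "\<phi> p q = {0}" if "\<not> (0 \<le> p \<and> 0 \<le> q \<and> p + q = n)" for p q
    using H that by (auto simp: hodge_structure_def)
  obtain w where w: "\<And>v p. w v p \<in> \<phi> p (n - p)" "\<And>v. v = (\<Sum>p=0..n. w v p)"
    using H unfolding hodge_structure_def by metis
  have wadd: "w (u + v) = (\<lambda>p. w u p + w v p)" for u v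
    by (rule hodge_decomp_unique[OF H])
      (auto simp: sum.distrib w(2)[symmetric] intro: vec.subspace_add[OF sub] w(1))
  have wscale: "w (c *s v) = (\<lambda>p. c *s w v p)" for c v
    by (rule hodge_decomp_unique[OF H])
      (auto simp: vec.scale_sum_right[symmetric] w(2)[symmetric] intro: vec.subspace_scale[OF sub] w(1))
  have wpure: "w v = (\<lambda>r. if r = p then v else 0)" if "v \<in> \<phi> p q" "0 \<le> p" "0 \<le> q" "p + q = n" for v p q
    by (rule hodge_decomp_unique[OF H])
      (use that w in \<open>auto simp: w(2)[symmetric] vec.subspace_0[OF sub] eq_diff_eq algebra_simps\<close>)
  define F where "F v = (\<Sum>p=0..n. (z powi p * cnj z powi (n - p)) *s w v p)" for v
  have lin: "Vector_Spaces.linear (*s) (*s) F"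
    by unfold_locales (auto simp: F_def wadd wscale vec.scale_right_distrib sum.distrib
        vec.scale_sum_right vec.scale_scale algebra_simps)
  show ?thesis
  proof (rule ex1I[of _ "matrix F"], intro allI ballI)
    fix p q v assume v: "v \<in> \<phi> p q"
    show "matrix F *v v = (z powi p * cnj z powi q) *s v"
    proof (cases "0 \<le> p \<and> 0 \<le> q \<and> p + q = n")
      case True
      then have q: "q = n - p" by auto
      have "F v = (\<Sum>r=0..n. if r = p then (z powi p * cnj z powi (n - p)) *s v else 0)"
        using True v unfolding F_def by (intro sum.cong) (auto simp: wpure)
      then show ?thesis using True by (simp add: matrix_works[OF lin] q)
    next
      case False
      then have "v = 0" using triv v by auto
      then show ?thesis by simp
    qed
  next
    fix A assume A: "\<forall>p q. \<forall>v\<in>\<phi> p q. A *v v = (z powi p * cnj z powi q) *s v"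
    have "A *v v = F v" for v
    proof -
      have "A *v v = A *v (\<Sum>p=0..n. w v p)" using w(2) by metis
      also have "\<dots> = F v" unfolding F_def using A w(1) 
        by (auto simp: vec.linear_sum[OF matrix_vector_mul_linear_gen] intro!: sum.cong)
      finally show ?thesis .
    qed
    then show "A = matrix F" by (simp add: matrix_eq matrix_works[OF lin])
  qed
qed

lemma rat_algebraic_group_Inter:
  assumes "\<And>H. H \<in> \<H> \<Longrightarrow> rat_algebraic_group H" "\<H> \<noteq> {}"
  shows "rat_algebraic_group (\<Inter>\<H>)"
proof -
  have "\<forall>H\<in>\<H>. \<exists>P. P \<subseteq> rat_polyfuns \<and> H = {A. invertible A \<and> (\<forall>f\<in>P. f A = 0)}"
    using assms(1) unfolding rat_algebraic_group_def by simp
  then obtain P where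
    P: "\<And>H. H \<in> \<H> \<Longrightarrow> P H \<subseteq> rat_polyfuns \<and> H = {A. invertible A \<and> (\<forall>f\<in>P H. f A = 0)}"
    using bchoice[of \<H>] by meson
  have memb: "A \<in> H \<longleftrightarrow> invertible A \<and> (\<forall>f\<in>P H. f A = 0)" if "H \<in> \<H>" for H A
    by (subst P[OF that, THEN conjunct2]) simp
  have "\<Inter>\<H> = {A. invertible A \<and> (\<forall>f\<in>\<Union>(P ` \<H>). f A = 0)}"
    using assms(2) by (auto simp: memb)
  moreover have "\<Union>(P ` \<H>) \<subseteq> rat_polyfuns" using P by (intro UN_least) simp
  moreover have "mat 1 \<in> \<Inter>\<H>" "\<forall>A\<in>\<Inter>\<H>. \<forall>B\<in>\<Inter>\<H>. A ** B \<in> \<Inter>\<H>"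
    "\<forall>A\<in>\<Inter>\<H>. matrix_inv A \<in> \<Inter>\<H>"
    using assms(1) by (simp_all add: rat_algebraic_group_def)
  ultimately show ?thesis unfolding rat_algebraic_group_def by (intro conjI exI) assumption+
qed

lemma hodge_rep_real_invertible:
  assumes H: "hodge_structure n \<phi>" and z: "z \<noteq> 0"
  shows "invertible (hodge_rep \<phi> z)" "hodge_rep \<phi> z $ i $ j \<in> \<real>"
proof -
  let ?P = "\<lambda>z A. \<forall>p q. \<forall>v\<in>\<phi> p q. A *v v = (z powi p * cnj z powi q) *s v"
  have ex: "\<exists>!A. ?P z A" for z by (rule hodge_rep_ex1[OF H])
  have rep: "?P z (hodge_rep \<phi> z)" for z unfolding hodge_rep_def by (rule theI'[OF ex])
  define A where "A = hodge_rep \<phi> z"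
  have one: "?P 1 (mat 1)" by simp
  have pr: "?P 1 (hodge_rep \<phi> (inverse z) ** A)" "?P 1 (A ** hodge_rep \<phi> (inverse z))"
    using rep[of z] rep[of "inverse z"] z
    by (auto simp: A_def matrix_vector_mul_assoc[symmetric] matrix_vector_mult_scaleR
       vec.linear_scale[OF matrix_vector_mul_linear_gen] power_int_inverse field_simps)
  show "invertible (hodge_rep \<phi> z)"
    using pr one ex[of 1] unfolding invertible_def A_def[symmetric] by metis
  define B where "B = (\<chi> i j. cnj (A $ i $ j))"
  have Bc: "B *v v = conj_vec (A *v conj_vec v)" for v
    by (simp add: B_def conj_vec_def matrix_vector_mult_def vec_eq_iff)
  have cc: "conj_vec (c *s conj_vec v) = cnj c *s v" for c v
    by (simp add: conj_vec_def vec_eq_iff)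
  have "?P z B"
  proof (intro allI ballI)
    fix p q v assume v: "v \<in> \<phi> p q"
    then have "conj_vec v \<in> \<phi> q p" using H unfolding hodge_structure_def by blast
    then show "B *v v = (z powi p * cnj z powi q) *s v"
      using rep[of z] by (simp add: Bc A_def cc mult.commute)
  qed
  then have "A = B" using ex[of z] rep[of z] unfolding A_def[symmetric] by blast
  then have "A $ i $ j = cnj (A $ i $ j)"
    by (simp add: B_def vec_eq_iff)
  then show "hodge_rep \<phi> z $ i $ j \<in> \<real>"
    unfolding A_def[symmetric] by (simp add: Reals_cnj_iff)
qed

lemma rat_algebraic_group_GL: "rat_algebraic_group {A::complex^'n^'n. invertible A}"
proof -
  have "invertible (matrix_inv A)" if "invertible A" for A :: "complex ^ 'n ^ 'n"
    using someI_ex[OF that[unfolded invertible_def]] unfolding invertible_def matrix_inv_def by blast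
  moreover have "\<exists>P\<subseteq>rat_polyfuns. {A. invertible A} = {A :: complex ^ 'n ^ 'n. invertible A \<and> (\<forall>f\<in>P. f A = 0)}"
    by (rule exI[of _ "{}"]) simp
  ultimately show ?thesis
    unfolding rat_algebraic_group_def by (auto simp: invertible_mult) (auto simp: invertible_def)
qed

lemma mumford_tate_least:
  assumes H: "hodge_structure n \<phi>"
  shows "rat_algebraic_group (mumford_tate \<phi>)"
    and "hodge_rep \<phi> ` sphere 0 1 \<subseteq> real_points (mumford_tate \<phi>)"
    and "\<And>H. rat_algebraic_group H \<Longrightarrow> hodge_rep \<phi> ` sphere 0 1 \<subseteq> real_points H \<Longrightarrow> mumford_tate \<phi> \<subseteq> H"
proof -
  define \<H> where
    "\<H> = {H. rat_algebraic_group H \<and> hodge_rep \<phi> ` sphere 0 1 \<subseteq> real_points H}"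
  have mt: "mumford_tate \<phi> = \<Inter>\<H>" by (simp add: mumford_tate_def \<H>_def)
  have inv: "invertible (hodge_rep \<phi> z)" and re: "hodge_rep \<phi> z $ i $ j \<in> \<real>"
    if "z \<in> sphere 0 1" for z i j
  proof -
    have "z \<noteq> 0" using that by auto
    then show "invertible (hodge_rep \<phi> z)" "hodge_rep \<phi> z $ i $ j \<in> \<real>"
      by (rule hodge_rep_real_invertible[OF H])+
  qed
  have "hodge_rep \<phi> ` sphere 0 1 \<subseteq> real_points {A. invertible A}"
    using inv re by (simp add: real_points_def image_subset_iff)
  then have "{A. invertible A} \<in> \<H>"
    unfolding \<H>_def by (simp add: rat_algebraic_group_GL)
  then have ne: "\<H> \<noteq> {}" by (metis empty_iff)
  show "rat_algebraic_group (mumford_tate \<phi>)"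
    unfolding mt by (rule rat_algebraic_group_Inter[OF _ ne]) (simp add: \<H>_def)
  show "hodge_rep \<phi> ` sphere 0 1 \<subseteq> real_points (mumford_tate \<phi>)"
    unfolding mt using re by (auto simp: real_points_def \<H>_def)
  show "mumford_tate \<phi> \<subseteq> H"
    if "rat_algebraic_group H" "hodge_rep \<phi> ` sphere 0 1 \<subseteq> real_points H" for H
    unfolding mt using that by (intro Inter_lower) (simp add: \<H>_def)
qed

end

theory Submission
  imports Defs "HOL-Computational_Algebra.Fundamental_Theorem_Algebra"
begin

text \<open>
  Let \<open>\<Gamma>\<close> be the group of field automorphisms of \<open>\<complex>\<close>; its fixed field is \<open>\<rat>\<close>. The Mumford-Tate group
  is cut out by rational equations, so it contains all conjugates of \<open>\<phi>(z)\<close>, and these commute since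
  \<open>\<phi>\<close> is CM. Hence every conjugate of a generator \<open>v\<^sub>0\<close> of \<open>V\<^sup>n\<^sup>,\<^sup>0\<close> lies in some \<open>V\<^sup>p\<^sup>,\<^sup>q\<close>. The span of
  these conjugates descends to a rational sub-Hodge structure, so it is \<open>V\<^sub>\<complex>\<close>, and the polarization
  shows that the distinct lines among them form a basis; \<open>\<Gamma>\<close> permutes these \<open>dim V\<close> lines transitively.

  A rational \<open>X \<in> \<gg>\<close> with components of degree \<open>-1, 0, 1\<close> maps \<open>v\<^sub>0\<close> to \<open>a v\<^sub>0 + b \<rho>(v\<^sub>0)\<close> where \<open>\<rho> \<in> \<Gamma>\<close>
  and \<open>\<rho>(v\<^sub>0)\<close> spans \<open>V\<^sup>n\<^sup>-\<^sup>1\<^sup>,\<^sup>1\<close>. If \<open>b \<noteq> 0\<close>, then \<open>\<tau>(v\<^sub>0) \<mapsto> \<tau>\<rho>(v\<^sub>0)\<close> is a well-defined map on the lines; skewness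
  of \<open>X\<close> makes it an involution, and together with complex conjugation it generates a free action of
  a group of order 4, but 4 does not divide \<open>dim V\<close>. So \<open>b = 0\<close>, and by transitivity \<open>X\<close> preserves every
  line.
\<close>

section \<open>Automorphisms of algebraically closed fields\<close>

definition subfield_of :: "'a::field set \<Rightarrow> bool" where
  "subfield_of K \<longleftrightarrow> 1 \<in> K \<and> (\<forall>a\<in>K. \<forall>b\<in>K. a - b \<in> K \<and> a * b \<in> K) \<and> (\<forall>a\<in>K. inverse a \<in> K)"

text \<open>Partial homomorphisms are represented by graphs, so that the upper bound of a chain is its union.\<close>

definition hom_graph :: "('a::field \<times> 'a) set \<Rightarrow> bool" where
  "hom_graph G \<longleftrightarrow> (1, 1) \<in> G \<and>
     (\<forall>a a' b b'. (a, a') \<in> G \<longrightarrow> (b, b') \<in> G \<longrightarrow> (a - b, a' - b') \<in> G \<and> (a * b, a' * b') \<in> G) \<and>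
     (\<forall>b. (0, b) \<in> G \<longrightarrow> b = 0)"

text \<open>Kept as a relation: \<open>p'\<close> is a coefficientwise image of \<open>p\<close>,
  and no value has to be chosen outside the domain of \<open>G\<close>.\<close>

definition graph_polys :: "('a::field \<times> 'a) set \<Rightarrow> 'a poly \<Rightarrow> 'a poly \<Rightarrow> bool" where
  "graph_polys G p p' \<longleftrightarrow> (\<forall>i. (coeff p i, coeff p' i) \<in> G)"

definition polys_over :: "'a::field set \<Rightarrow> 'a poly set" where
  "polys_over K = {p. \<forall>i. coeff p i \<in> K}"

section \<open>Calculus of partial homomorphisms and adjunction of one algebraic element\<close>

context
  fixes G :: "('a::field \<times> 'a) set"
  assumes G: "hom_graph G"
begin

lemma hom_graph_one: "(1, 1) \<in> G"
  and hom_graph_diff: "(a, a') \<in> G \<Longrightarrow> (b, b') \<in> G \<Longrightarrow> (a - b, a' - b') \<in> G"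
  and hom_graph_mult: "(a, a') \<in> G \<Longrightarrow> (b, b') \<in> G \<Longrightarrow> (a * b, a' * b') \<in> G"
  and hom_graph_zeroD: "(0, b) \<in> G \<Longrightarrow> b = 0"
  using G by (auto simp: hom_graph_def)

lemma hom_graph_zero: "(0, 0) \<in> G"
  using hom_graph_diff[OF hom_graph_one hom_graph_one] by simp

lemma hom_graph_add: "(a, a') \<in> G \<Longrightarrow> (b, b') \<in> G \<Longrightarrow> (a + b, a' + b') \<in> G"
  using hom_graph_diff[OF _ hom_graph_diff[OF hom_graph_zero], of a a' b b'] by simp

text \<open>Subtracting the two pairs leaves a pair over 0; this is why \<open>hom_graph\<close>
  constrains only that fibre.\<close>

lemma hom_graph_unique: "(a, b) \<in> G \<Longrightarrow> (a, c) \<in> G \<Longrightarrow> b = c"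
  using hom_graph_diff[of a b a c] hom_graph_zeroD[of "b - c"] by simp

lemma hom_graph_sum:
  "(\<And>i. i \<in> I \<Longrightarrow> (f i, g i) \<in> G) \<Longrightarrow> (sum f I, sum g I) \<in> G"
  by (induction I rule: infinite_finite_induct) (auto intro: hom_graph_zero hom_graph_add)

lemma hom_graph_power: "(a, a') \<in> G \<Longrightarrow> (a ^ k, a' ^ k) \<in> G"
  by (induction k) (auto intro: hom_graph_one hom_graph_mult)

lemma graph_polys_const: "(a, a') \<in> G \<Longrightarrow> graph_polys G [:a:] [:a':]"
  by (auto simp: graph_polys_def coeff_pCons hom_graph_zero split: nat.split)

lemma graph_polys_X: "graph_polys G [:0, 1:] [:0, 1:]"
  by (auto simp: graph_polys_def coeff_pCons hom_graph_zero hom_graph_one split: nat.split)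

lemma graph_polys_monom: "(a, a') \<in> G \<Longrightarrow> graph_polys G (monom a k) (monom a' k)"
  by (auto simp: graph_polys_def hom_graph_zero)

lemma graph_polys_diff:
  "graph_polys G p p' \<Longrightarrow> graph_polys G q q' \<Longrightarrow> graph_polys G (p - q) (p' - q')"
  by (auto simp: graph_polys_def intro: hom_graph_diff)

lemma graph_polys_mult:
  "graph_polys G p p' \<Longrightarrow> graph_polys G q q' \<Longrightarrow> graph_polys G (p * q) (p' * q')"
  by (auto simp: graph_polys_def coeff_mult intro!: hom_graph_sum hom_graph_mult)

lemma graph_polys_zeroD: "graph_polys G 0 p' \<Longrightarrow> p' = 0"
  by (auto simp: graph_polys_def poly_eq_iff dest: hom_graph_zeroD)

lemma graph_polys_degree_le: "graph_polys G p p' \<Longrightarrow> degree p' \<le> degree p"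
  by (rule degree_le) (metis coeff_eq_0 graph_polys_def hom_graph_zeroD)

lemma hom_graph_poly:
  assumes "graph_polys G p p'" "(a, a') \<in> G"
  shows "(poly p a, poly p' a') \<in> G"
proof -
  have "poly p' a' = (\<Sum>i\<le>degree p. coeff p' i * a' ^ i)"
    unfolding poly_altdef using graph_polys_degree_le[OF assms(1)]
    by (intro sum.mono_neutral_left) (auto simp: coeff_eq_0)
  then show ?thesis
    using assms unfolding poly_altdef[of p] graph_polys_def
    by (auto intro!: hom_graph_sum hom_graph_mult hom_graph_power)
qed

text \<open>Euclidean division of \<open>p\<close> by the monic \<open>m\<close>, one leading term
  at a time and mirrored on \<open>p'\<close> and \<open>m'\<close>. Each remainder still vanishes
  at \<open>t\<close>, so minimality of \<open>m\<close> forces it down to 0. This makes the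
  assignment of \<open>poly p' s\<close> to \<open>poly p t\<close> well defined.\<close>

lemma graph_polys_root:
  assumes m: "graph_polys G m m'" "lead_coeff m = 1" "poly m' s = 0"
    and min: "\<And>p p'. graph_polys G p p' \<Longrightarrow> poly p t = 0 \<Longrightarrow> p \<noteq> 0 \<Longrightarrow> degree m \<le> degree p"
    and "poly m t = 0"
    and "graph_polys G p p'" "poly p t = 0"
  shows "poly p' s = 0"
  using assms(6,7)
proof (induction "degree p" arbitrary: p p' rule: less_induct)
  case less
  show ?case
  proof (cases "p = 0")
    case True
    then have "p' = 0" using graph_polys_zeroD less.prems by blast
    then show ?thesis by simp
  next
    case False
    define c where "c = lead_coeff p"
    \<comment> \<open>The coefficient of \<open>p'\<close> is read off at \<open>degree p\<close>,
      even if \<open>p'\<close> has smaller degree, so that \<open>(c, c')\<close> lies in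
      \<open>G\<close>.\<close>
    define c' where "c' = coeff p' (degree p)"
    define k where "k = degree p - degree m"
    have deg: "degree p = k + degree m"
      using min[OF less.prems False] by (simp add: k_def)
    define r where "r = p - monom c k * m"
    define r' where "r' = p' - monom c' k * m'"
    have rr: "graph_polys G r r'"
      unfolding r_def r'_def using less.prems(1) m(1)
      by (intro graph_polys_diff graph_polys_mult graph_polys_monom)
        (auto simp: graph_polys_def c_def c'_def)
    have rt: "poly r t = 0"
      using less.prems \<open>poly m t = 0\<close> by (simp add: r_def)
    have "degree r \<le> degree p" "coeff r (degree p) = 0"
      using m(2) deg
      by (auto simp: r_def c_def coeff_monom_mult intro!: degree_diff_le order.trans[OF degree_mult_le]
          order.trans[OF add_mono[OF degree_monom_le order.refl]])
    then consider "r = 0" | "degree r < degree p"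
      using eq_zero_or_degree_less by blast
    then have "poly r' s = 0"
    proof cases
      case 1
      then have "r' = 0" using graph_polys_zeroD rr by blast
      then show ?thesis by simp
    next
      case 2
      then show ?thesis using less.hyps rr rt by blast
    qed
    then show ?thesis using m(3) by (simp add: r'_def)
  qed
qed

text \<open>The extension is evaluation, sending \<open>poly p t\<close> to
  \<open>poly p' s\<close>; \<open>graph_polys_root\<close> gives the condition on the fibre over 0.
  Only polynomial values in \<open>t\<close> are added; inverses come later from
  algebraicity.\<close>

lemma hom_graph_adjoin:
  assumes m: "graph_polys G m m'" "lead_coeff m = 1" "poly m' s = 0"
    and min: "\<And>p p'. graph_polys G p p' \<Longrightarrow> poly p t = 0 \<Longrightarrow> p \<noteq> 0 \<Longrightarrow> degree m \<le> degree p"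
    and mt: "poly m t = 0"
  obtains G' where "hom_graph G'" "G \<subseteq> G'" "(t, s) \<in> G'"
proof
  let ?G = "{(poly p t, poly p' s) | p p'. graph_polys G p p'}"
  have memI: "(a, a') \<in> ?G" if "graph_polys G p p'" "a = poly p t" "a' = poly p' s" for a a' p p'
    using that by blast
  show "G \<subseteq> ?G"
  proof clarify
    fix a a' assume "(a, a') \<in> G"
    then have "graph_polys G [:a:] [:a':]" by (rule graph_polys_const)
    then show "\<exists>p p'. (a, a') = (poly p t, poly p' s) \<and> graph_polys G p p'"
      by (intro exI[of _ "[:a:]"] exI[of _ "[:a':]"]) auto
  qed
  show "(t, s) \<in> ?G"
    by (rule memI[OF graph_polys_X]) auto
  show "hom_graph ?G"
    unfolding hom_graph_def
  proof (intro conjI allI impI)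
    show "(1, 1) \<in> ?G"
      by (rule memI[OF graph_polys_const[OF hom_graph_one]]) auto
  next
    fix a a' b b' assume "(a, a') \<in> ?G" "(b, b') \<in> ?G"
    then obtain p p' q q' where *: "graph_polys G p p'" "a = poly p t" "a' = poly p' s"
      "graph_polys G q q'" "b = poly q t" "b' = poly q' s" by blast
    show "(a - b, a' - b') \<in> ?G"
      by (rule memI[OF graph_polys_diff[OF *(1,4)]]) (auto simp: *)
    show "(a * b, a' * b') \<in> ?G"
      by (rule memI[OF graph_polys_mult[OF *(1,4)]]) (auto simp: *)
  next
    fix b assume "(0, b) \<in> ?G"
    then obtain p p' where p: "graph_polys G p p'" "0 = poly p t" "b = poly p' s" by blast
    show "b = 0"
      unfolding p(3) by (rule graph_polys_root[OF m min mt p(1) p(2)[symmetric]])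
  qed
qed

end

section \<open>Subfields and simple extensions\<close>

context
  fixes K :: "'a::field set"
  assumes K: "subfield_of K"
begin

lemma subfield_one: "1 \<in> K"
  and subfield_diff: "a \<in> K \<Longrightarrow> b \<in> K \<Longrightarrow> a - b \<in> K"
  and subfield_mult: "a \<in> K \<Longrightarrow> b \<in> K \<Longrightarrow> a * b \<in> K"
  and subfield_inverse: "a \<in> K \<Longrightarrow> inverse a \<in> K"
  using K by (auto simp: subfield_of_def)

lemma subfield_divide: "a \<in> K \<Longrightarrow> b \<in> K \<Longrightarrow> a / b \<in> K"
  by (simp add: divide_inverse subfield_mult subfield_inverse)

lemma hom_graph_Id_on: "hom_graph (Id_on K)"
  using K by (auto simp: hom_graph_def subfield_of_def)

text \<open>Reduces closure properties of \<open>polys_over\<close> to those of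
  \<open>graph_polys\<close> for the identity homomorphism.\<close>

lemma polys_over_iff: "p \<in> polys_over K \<longleftrightarrow> graph_polys (Id_on K) p p"
  by (auto simp: polys_over_def graph_polys_def)

lemma polys_over_diff: "p \<in> polys_over K \<Longrightarrow> q \<in> polys_over K \<Longrightarrow> p - q \<in> polys_over K"
  and polys_over_mult: "p \<in> polys_over K \<Longrightarrow> q \<in> polys_over K \<Longrightarrow> p * q \<in> polys_over K"
  and polys_over_const: "a \<in> K \<Longrightarrow> [:a:] \<in> polys_over K"
  and polys_over_X: "[:0, 1:] \<in> polys_over K"
  unfolding polys_over_iff
  by (auto intro!: graph_polys_diff graph_polys_mult graph_polys_const graph_polys_X hom_graph_Id_on)

lemma subfield_zero: "0 \<in> K"
  using subfield_diff[OF subfield_one subfield_one] by simp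

lemma subfield_add: "a \<in> K \<Longrightarrow> b \<in> K \<Longrightarrow> a + b \<in> K"
  using subfield_diff[OF _ subfield_diff[OF subfield_zero], of a b] by simp

lemma polys_over_add: "p \<in> polys_over K \<Longrightarrow> q \<in> polys_over K \<Longrightarrow> p + q \<in> polys_over K"
  using polys_over_diff[OF _ polys_over_diff[OF polys_over_const[OF subfield_zero]], of p q] by simp

lemma polys_over_power: "p \<in> polys_over K \<Longrightarrow> p ^ k \<in> polys_over K"
  by (induction k) (use polys_over_const[OF subfield_one] in \<open>auto intro: polys_over_mult simp: one_pCons\<close>)

lemma polys_over_sum: "(\<And>i. i \<in> I \<Longrightarrow> f i \<in> polys_over K) \<Longrightarrow> sum f I \<in> polys_over K"
  by (induction I rule: infinite_finite_induct)
    (auto intro: polys_over_add polys_over_const[OF subfield_zero, simplified])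

text \<open>The set is the simple extension \<open>K(y)\<close>. Fractions are used because
  \<open>y\<close> may be transcendental.\<close>

lemma subfield_adjoin:
  "subfield_of {poly p y / poly q y | p q. p \<in> polys_over K \<and> q \<in> polys_over K \<and> poly q y \<noteq> 0}"
    (is "subfield_of ?L")
proof -
  have memI: "a \<in> ?L" if "p \<in> polys_over K" "q \<in> polys_over K" "poly q y \<noteq> 0" "a = poly p y / poly q y"
    for a p q using that by blast
  have 1: "[:1:] \<in> polys_over K" using polys_over_const subfield_one by blast
  show ?thesis unfolding subfield_of_def
  proof (intro conjI ballI)
    show "1 \<in> ?L" by (rule memI[OF 1 1]) auto
  next
    fix a b assume "a \<in> ?L" "b \<in> ?L"
    then obtain p q p' q' where *: "p \<in> polys_over K" "q \<in> polys_over K" "poly q y \<noteq> 0" "a = poly p y / poly q y"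
      "p' \<in> polys_over K" "q' \<in> polys_over K" "poly q' y \<noteq> 0" "b = poly p' y / poly q' y" by blast
    show "a - b \<in> ?L"
      by (rule memI[of "p * q' - p' * q" "q * q'"])
        (use *(1,2,3,5,6,7) in \<open>auto intro!: polys_over_diff polys_over_mult simp: *(4,8) diff_frac_eq\<close>)
    show "a * b \<in> ?L"
      by (rule memI[of "p * p'" "q * q'"])
        (use *(1,2,3,5,6,7) in \<open>auto intro!: polys_over_mult simp: *(4,8)\<close>)
  next
    fix a assume "a \<in> ?L"
    then obtain p q where *: "p \<in> polys_over K" "q \<in> polys_over K" "poly q y \<noteq> 0" "a = poly p y / poly q y"
      by blast
    show "inverse a \<in> ?L"
    proof (cases "poly p y = 0")
      case True
      then show ?thesis
        by (intro memI[of 0 "[:1:]"]) (use 1 * polys_over_diff[OF 1 1] in auto)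
    next
      case False
      then show ?thesis by (intro memI[of q p]) (use * in auto)
    qed
  qed
qed

end

lemma subfield_Rats: "subfield_of (\<rat> :: 'a::field_char_0 set)"
  by (auto simp: subfield_of_def)

lemma subfield_Union_chain:
  assumes "\<C> \<noteq> {}" "\<And>K L. K \<in> \<C> \<Longrightarrow> L \<in> \<C> \<Longrightarrow> K \<subseteq> L \<or> L \<subseteq> K" "\<And>K. K \<in> \<C> \<Longrightarrow> subfield_of K"
  shows "subfield_of (\<Union>\<C>)"
  unfolding subfield_of_def
proof (intro conjI ballI)
  show "1 \<in> \<Union>\<C>" using assms(1,3) subfield_one by blast
  fix a assume "a \<in> \<Union>\<C>"
  then show "inverse a \<in> \<Union>\<C>" using assms(3) subfield_inverse by blast
  fix b assume "b \<in> \<Union>\<C>"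
  with \<open>a \<in> \<Union>\<C>\<close> obtain K where K: "K \<in> \<C>" "a \<in> K" "b \<in> K" using assms(2) by blast
  then show "a - b \<in> \<Union>\<C>" "a * b \<in> \<Union>\<C>"
    using assms(3) subfield_diff subfield_mult by blast+
qed

lemma hom_graph_Union_chain:
  assumes "\<C> \<noteq> {}" "\<And>K L. K \<in> \<C> \<Longrightarrow> L \<in> \<C> \<Longrightarrow> K \<subseteq> L \<or> L \<subseteq> K" "\<And>K. K \<in> \<C> \<Longrightarrow> hom_graph K"
  shows "hom_graph (\<Union>\<C>)"
  unfolding hom_graph_def
proof (intro conjI allI impI)
  show "(1, 1) \<in> \<Union>\<C>" using assms(1,3) hom_graph_one by blast
  show "b = 0" if "(0, b) \<in> \<Union>\<C>" for b using that assms(3) hom_graph_zeroD by blast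
  fix a a' b b' assume "(a, a') \<in> \<Union>\<C>" "(b, b') \<in> \<Union>\<C>"
  then obtain K where K: "K \<in> \<C>" "(a, a') \<in> K" "(b, b') \<in> K" using assms(2) by blast
  then show "(a - b, a' - b') \<in> \<Union>\<C>" "(a * b, a' * b') \<in> \<Union>\<C>"
    using assms(3) hom_graph_diff hom_graph_mult by blast+
qed

section \<open>Algebraicity over a maximal subfield avoiding an element\<close>

definition algebraic_over :: "'a::field set \<Rightarrow> 'a \<Rightarrow> bool" where
  "algebraic_over K t \<longleftrightarrow> (\<exists>p\<in>polys_over K. p \<noteq> 0 \<and> poly p t = 0)"

lemma monic_minimal_poly:
  assumes "subfield_of K" "algebraic_over K t"
  obtains m where "m \<in> polys_over K" "lead_coeff m = 1" "poly m t = 0"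
    "\<forall>p\<in>polys_over K. p \<noteq> 0 \<longrightarrow> poly p t = 0 \<longrightarrow> degree m \<le> degree p"
proof -
  define P where "P = (\<lambda>p. p \<in> polys_over K \<and> p \<noteq> 0 \<and> poly p t = 0)"
  have "\<exists>p. P p" using assms(2) by (auto simp: algebraic_over_def P_def)
  then obtain m where m: "P m" "\<And>p. P p \<Longrightarrow> degree m \<le> degree p"
    using ex_has_least_nat[of P _ degree] by blast
  let ?m = "smult (inverse (lead_coeff m)) m"
  show ?thesis
  proof (rule that[of ?m])
    show "?m \<in> polys_over K"
      using m(1) assms(1) by (auto simp: P_def polys_over_def intro: subfield_mult subfield_inverse)
  qed (use m in \<open>auto simp: P_def\<close>)
qed

text \<open>A substitute for a transcendence basis: everything turns out to be algebraic over such
  an \<open>F\<close>, while \<open>x\<close> still lies outside it.\<close>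

lemma exists_maximal_subfield_avoiding:
  fixes x :: "'a::field_char_0"
  assumes "x \<notin> \<rat>"
  obtains F where "subfield_of F" "x \<notin> F" "\<forall>L. subfield_of L \<longrightarrow> F \<subseteq> L \<longrightarrow> L \<noteq> F \<longrightarrow> x \<in> L"
proof -
  have "\<exists>M\<in>{K. subfield_of K \<and> x \<notin> K}. \<forall>X\<in>{K. subfield_of K \<and> x \<notin> K}. M \<subseteq> X \<longrightarrow> X = M"
  proof (rule subset_Zorn_nonempty)
    show "{K. subfield_of K \<and> x \<notin> K} \<noteq> {}" using assms subfield_Rats by blast
  next
    fix \<C> assume "\<C> \<noteq> {}" "subset.chain {K. subfield_of K \<and> x \<notin> K} \<C>"
    then show "\<Union>\<C> \<in> {K. subfield_of K \<and> x \<notin> K}"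
      unfolding subset_chain_def by (auto intro!: subfield_Union_chain)
  qed
  then show ?thesis using that by blast
qed

text \<open>
  By maximality \<open>x \<in> F(x\<^sup>2)\<close> unless \<open>x\<^sup>2 \<in> F\<close>, and comparing the parity of degrees makes \<open>x\<close> algebraic
  over \<open>F\<close>. For \<open>t \<notin> F\<close> the element \<open>x\<close> lies in \<open>F(t)\<close> but not in \<open>F\<close>, so \<open>t\<close> cannot be transcendental.
\<close>

lemma maximal_subfield_avoiding_algebraic:
  fixes x :: "'a::field_char_0"
  assumes F: "subfield_of F" "x \<notin> F" and max: "\<forall>L. subfield_of L \<longrightarrow> F \<subseteq> L \<longrightarrow> L \<noteq> F \<longrightarrow> x \<in> L"
  shows "algebraic_over F t"
proof -
  have one: "[:1:] \<in> polys_over F" by (rule polys_over_const[OF F(1) subfield_one[OF F(1)]])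
  have ratfun: "\<exists>p\<in>polys_over F. \<exists>q\<in>polys_over F. poly q y \<noteq> 0 \<and> x = poly p y / poly q y" if "y \<notin> F" for y
  proof -
    let ?L = "{poly p y / poly q y | p q. p \<in> polys_over F \<and> q \<in> polys_over F \<and> poly q y \<noteq> 0}"
    have memI: "poly p y \<in> ?L" if "p \<in> polys_over F" for p
      using one that by (fastforce intro: exI[of _ p] exI[of _ "[:1:]"])
    have "a \<in> ?L" if "a \<in> F" for a
      using memI[OF polys_over_const[OF F(1) that]] by simp
    moreover have "y \<in> ?L"
      using memI[OF polys_over_X[OF F(1)]] by simp
    ultimately have "x \<in> ?L"
      using that max[rule_format, OF subfield_adjoin[OF F(1), of y]] by blast
    then show ?thesis by blast
  qed
  have const_alg: "algebraic_over F a" if "a \<in> F" for a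
    unfolding algebraic_over_def
    using that polys_over_diff[OF F(1) polys_over_X[OF F(1)] polys_over_const[OF F(1) that]]
    by (intro bexI[of _ "[:0, 1:] - [:a:]"]) auto
  have x_alg: "algebraic_over F x"
  proof (cases "x * x \<in> F")
    case True
    have "[:0, 1:] * [:0, 1:] - [:x * x:] \<in> polys_over F"
      using F(1) True by (intro polys_over_diff polys_over_mult polys_over_X polys_over_const) auto
    then show ?thesis
      unfolding algebraic_over_def by (rule bexI[rotated]) (simp add: algebra_simps)
  next
    case False
    then obtain p q where pq: "p \<in> polys_over F" "q \<in> polys_over F" "poly q (x * x) \<noteq> 0"
      "x = poly p (x * x) / poly q (x * x)" using ratfun by blast
    define p2 q2 where "p2 = p \<circ>\<^sub>p ([:0, 1:] * [:0, 1:])" and "q2 = q \<circ>\<^sub>p ([:0, 1:] * [:0, 1:])"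
    have comp: "r \<circ>\<^sub>p ([:0, 1:] * [:0, 1:]) \<in> polys_over F" if "r \<in> polys_over F" for r
    proof -
      have "[:coeff r i:] \<in> polys_over F" for i
        using that by (intro polys_over_const[OF F(1)]) (simp add: polys_over_def)
      then show ?thesis
        unfolding pcompose_altdef poly_altdef
        by (auto intro!: polys_over_sum polys_over_mult polys_over_power polys_over_X F(1)
            simp: coeff_map_poly simp del: mult_pCons_left mult_pCons_right)
    qed
    let ?r = "[:0, 1:] * q2 - p2"
    have "?r \<in> polys_over F"
      unfolding p2_def q2_def using pq(1,2) comp F(1) by (intro polys_over_diff polys_over_mult polys_over_X) auto
    moreover have "poly ?r x = 0"
      using pq(3,4) by (simp add: p2_def q2_def poly_pcompose field_simps)
    moreover have "?r \<noteq> 0"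
    proof
      assume "?r = 0"
      then have "degree p2 = degree ([:0, 1:] * q2)" by simp
      moreover have "q2 \<noteq> 0" using pq(3) by (auto simp: q2_def poly_pcompose dest!: arg_cong[where f = "\<lambda>p. poly p x"])
      ultimately have "degree p2 = Suc (degree q2)" by simp
      moreover have "even (degree p2)" "even (degree q2)"
        unfolding p2_def q2_def degree_pcompose by simp_all
      ultimately show False by simp
    qed
    ultimately show ?thesis unfolding algebraic_over_def by blast
  qed
  show ?thesis
  proof (cases "t \<in> F")
    case False
    then obtain p q where pq: "p \<in> polys_over F" "q \<in> polys_over F" "poly q t \<noteq> 0"
      "x = poly p t / poly q t" using ratfun by blast
    obtain m where m: "m \<in> polys_over F" "m \<noteq> 0" "poly m x = 0"
      using x_alg unfolding algebraic_over_def by blast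
    \<comment> \<open>This is \<open>m\<close> evaluated at \<open>p / q\<close> with denominators
      cleared, so it vanishes at \<open>t\<close>.\<close>
    define r where "r = (\<Sum>i\<le>degree m. [:coeff m i:] * (p ^ i * q ^ (degree m - i)))"
    have r: "poly r u = poly q u ^ degree m * poly m (poly p u / poly q u)" if "poly q u \<noteq> 0" for u
      unfolding r_def poly_sum poly_altdef[of m] sum_distrib_left
      using that by (intro sum.cong) (auto simp: field_simps power_diff)
    have "r \<in> polys_over F"
      unfolding r_def using m(1) pq F(1)
      by (intro polys_over_sum polys_over_mult polys_over_power polys_over_const) (auto simp: polys_over_def)
    moreover have "poly r t = 0" using r pq(3,4) m(3) by simp
    moreover have "r \<noteq> 0"
    proof
      assume "r = 0"
      \<comment> \<open>If \<open>r = 0\<close>, then away from the zeros of \<open>q\<close> the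
        function \<open>p / q\<close> takes only roots of \<open>m\<close> as values, so
        \<open>w\<close> vanishes everywhere. Over an infinite field this makes \<open>p\<close> a
        constant multiple of \<open>q\<close>, and \<open>x\<close> would be that constant, a
        quotient of coefficients in \<open>F\<close>.\<close>
      define w where "w = q * (\<Prod>z\<in>{z. poly m z = 0}. p - smult z q)"
      have fin: "finite {z. poly m z = 0}" using m(2) by (rule poly_roots_finite)
      have "poly w u = 0" for u
      proof (cases "poly q u = 0")
        case False
        then have "poly m (poly p u / poly q u) = 0" using r[of u] \<open>r = 0\<close> by simp
        then have "poly (\<Prod>z\<in>{z. poly m z = 0}. p - smult z q) u = 0"
          unfolding poly_prod using fin False by (intro prod_zero) (auto intro!: bexI[of _ "poly p u / poly q u"])
        then show ?thesis by (simp add: w_def)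
      qed (simp add: w_def)
      then have "w = 0" using poly_all_0_iff_0 by blast
      moreover have "q \<noteq> 0" using pq(3) by auto
      ultimately obtain z where z: "p = smult z q" using fin by (auto simp: w_def)
      have "coeff p (degree q) / lead_coeff q \<in> F"
        using pq(1,2) F(1) by (intro subfield_divide) (auto simp: polys_over_def)
      then have "z \<in> F" using z \<open>q \<noteq> 0\<close> by simp
      moreover have "x = z" using pq(3,4) z by simp
      ultimately show False using F(2) by simp
    qed
    ultimately show ?thesis unfolding algebraic_over_def by blast
  qed (rule const_alg)
qed

section \<open>Extension to automorphisms and the fixed field\<close>

definition field_aut :: "('a::field \<Rightarrow> 'a) \<Rightarrow> bool" where
  "field_aut \<sigma> \<longleftrightarrow> bij \<sigma> \<and> (\<forall>a b. \<sigma> (a + b) = \<sigma> a + \<sigma> b) \<and> (\<forall>a b. \<sigma> (a * b) = \<sigma> a * \<sigma> b)"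

text \<open>A maximal extension of \<open>G0\<close> has full domain: a missing \<open>t\<close>
  could be sent to a root of its transported minimal polynomial. Since \<open>F\<close> is fixed
  pointwise and everything is algebraic over it, the resulting injective map is also onto.\<close>

lemma hom_graph_extends_to_aut:
  fixes F :: "'a::alg_closed_field set"
  assumes F: "subfield_of F" and alg: "\<And>t. algebraic_over F t"
    and G0: "hom_graph G0" "Id_on F \<subseteq> G0" "(x, y) \<in> G0"
  obtains \<sigma> where "field_aut \<sigma>" "\<sigma> x = y"
proof -
  let ?\<G> = "{G. hom_graph G \<and> G0 \<subseteq> G}"
  have "\<exists>M\<in>?\<G>. \<forall>X\<in>?\<G>. M \<subseteq> X \<longrightarrow> X = M"
  proof (rule subset_Zorn_nonempty)
    show "?\<G> \<noteq> {}" using G0 by blast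
    fix \<C> assume \<C>: "\<C> \<noteq> {}" "subset.chain ?\<G> \<C>"
    then have "hom_graph (\<Union>\<C>)"
      unfolding subset_chain_def by (intro hom_graph_Union_chain) blast+
    then show "\<Union>\<C> \<in> ?\<G>"
      using \<C> unfolding subset_chain_def by blast
  qed
  then obtain G where G: "hom_graph G" "G0 \<subseteq> G" and max: "\<And>X. hom_graph X \<Longrightarrow> G \<subseteq> X \<Longrightarrow> X = G"
    by (auto dest: order.trans)
  note hg = hom_graph_one[OF G(1)] hom_graph_diff[OF G(1)] hom_graph_mult[OF G(1)]
  have FG: "(a, a) \<in> G" if "a \<in> F" for a using that G0(2) G(2) by auto
  have FD: "F \<subseteq> Domain G" using FG by auto
  have sub: "subfield_of (Domain G)"
    unfolding subfield_of_def
  proof (intro conjI ballI)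
    fix u assume u: "u \<in> Domain G"
    show "inverse u \<in> Domain G"
    proof (cases "u = 0")
      case False
      obtain m where m: "m \<in> polys_over F" "lead_coeff m = 1" "poly m u = 0"
        "\<forall>p\<in>polys_over F. p \<noteq> 0 \<longrightarrow> poly p u = 0 \<longrightarrow> degree m \<le> degree p"
        by (rule monic_minimal_poly[OF F alg])
      \<comment> \<open>Writing the minimal polynomial as \<open>c + X q\<close> with
        \<open>c\<close> nonzero expresses \<open>inverse u\<close> as a polynomial in
        \<open>u\<close> over \<open>F\<close>, so the ring \<open>Domain G\<close> is a
        field.\<close>
      obtain c q where mc: "m = pCons c q" by (cases m)
      have q: "q \<in> polys_over F" "c \<in> F"
        using m(1) unfolding polys_over_def mc by (auto simp: coeff_pCons split: nat.splits)
      have "m \<noteq> 0" using m(2) by auto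
      have "c \<noteq> 0"
      proof
        assume "c = 0"
        then have "poly q u = 0" "q \<noteq> 0" using m(3) mc False \<open>m \<noteq> 0\<close> by auto
        then have "degree m \<le> degree q" using m(4) q by blast
        then show False using mc \<open>q \<noteq> 0\<close> by simp
      qed
      moreover have "c + u * poly q u = 0" using m(3) mc by simp
      ultimately have inv: "inverse u = (0 - inverse c) * poly q u"
        using False by (simp add: field_simps) (metis add.commute add_eq_0_iff mult.commute)
      obtain u' where "(u, u') \<in> G" using u by auto
      then have "(poly q u, poly q u') \<in> G"
        using q(1) FG by (intro hom_graph_poly[OF G(1)]) (auto simp: graph_polys_def polys_over_def)
      moreover have "0 - inverse c \<in> F"
        using q(2) F by (intro subfield_diff subfield_zero subfield_inverse) auto
      ultimately show ?thesis unfolding inv using hg(3) FG by blast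
    qed (use FD subfield_zero[OF F] in auto)
  qed (use hg in blast)+
  have dom: "Domain G = UNIV"
  proof (rule ccontr)
    assume "Domain G \<noteq> UNIV"
    then obtain t where t: "t \<notin> Domain G" by auto
    have algt: "algebraic_over (Domain G) t"
      using alg[of t] FD unfolding algebraic_over_def polys_over_def by blast
    obtain m where m: "m \<in> polys_over (Domain G)" "lead_coeff m = 1" "poly m t = 0"
      "\<forall>p\<in>polys_over (Domain G). p \<noteq> 0 \<longrightarrow> poly p t = 0 \<longrightarrow> degree m \<le> degree p"
      by (rule monic_minimal_poly[OF sub algt])
    have "\<forall>a\<in>Domain G. \<exists>b. (a, b) \<in> G" by blast
    then obtain g where g: "\<And>a. a \<in> Domain G \<Longrightarrow> (a, g a) \<in> G" using bchoice by metis
    have g0: "g 0 = 0" using g[OF subfield_zero[OF sub]] hom_graph_zeroD[OF G(1)] by blast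
    define m' where "m' = map_poly g m"
    have mm: "graph_polys G m m'"
      using g m(1) by (auto simp: graph_polys_def m'_def coeff_map_poly g0 polys_over_def)
    \<comment> \<open>The monic leading term survives transport, so \<open>m'\<close> is nonconstant
      and has a root.\<close>
    have "(1, coeff m' (degree m)) \<in> G" using mm m(2) unfolding graph_polys_def by metis
    then have "coeff m' (degree m) = 1" using hom_graph_unique[OF G(1) _ hg(1)] by blast
    then have "degree m \<le> degree m'" by (intro le_degree) auto
    moreover have "degree m \<noteq> 0"
    proof
      assume "degree m = 0"
      then obtain c where "m = [:c:]" by (metis degree_eq_zeroE)
      then show False using m(2,3) by auto
    qed
    ultimately have "degree m' > 0" by simp
    then obtain s where s: "poly m' s = 0" using alg_closed_imp_poly_has_root by blast
    have min: "degree m \<le> degree p" if "graph_polys G p p'" "poly p t = 0" "p \<noteq> 0" for p p'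
      using that m(4) by (auto simp: graph_polys_def polys_over_def)
    obtain G' where "hom_graph G'" "G \<subseteq> G'" "(t, s) \<in> G'"
      by (rule hom_graph_adjoin[OF G(1) mm m(2) s min m(3)])
    then show False using max t by blast
  qed
  define \<sigma> where "\<sigma> a = (THE b. (a, b) \<in> G)" for a
  have \<sigma>: "\<sigma> a = b" if "(a, b) \<in> G" for a b
    unfolding \<sigma>_def using that hom_graph_unique[OF G(1)] by blast
  have \<sigma>G: "(a, \<sigma> a) \<in> G" for a using dom \<sigma> by (metis DomainE UNIV_I)
  have add: "\<sigma> (a + b) = \<sigma> a + \<sigma> b" and mult: "\<sigma> (a * b) = \<sigma> a * \<sigma> b" and diff: "\<sigma> (a - b) = \<sigma> a - \<sigma> b" for a b
    using hom_graph_add[OF G(1)] hg \<sigma>G by (auto intro!: \<sigma>)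
  have "inj \<sigma>"
  proof (rule injI)
    fix a b assume "\<sigma> a = \<sigma> b"
    then have "\<sigma> (a - b) = 0" by (simp add: diff)
    moreover have "\<sigma> ((a - b) * inverse (a - b)) = \<sigma> (a - b) * \<sigma> (inverse (a - b))" by (rule mult)
    moreover have "\<sigma> 1 = 1" using \<sigma> hg(1) by blast
    ultimately show "a = b" by (metis mult_zero_left right_inverse right_minus_eq zero_neq_one)
  qed
  moreover have "b \<in> range \<sigma>" for b
  proof -
    \<comment> \<open>The finitely many roots of a polynomial over \<open>F\<close> that kills
      \<open>b\<close> are mapped injectively among themselves, hence permuted, so \<open>b\<close>
      is attained.\<close>
    obtain p where p: "p \<in> polys_over F" "p \<noteq> 0" "poly p b = 0"
      using alg unfolding algebraic_over_def by blast
    let ?Z = "{z. poly p z = 0}"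
    have "poly p (\<sigma> z) = \<sigma> (poly p z)" for z
      using p(1) FG \<sigma>G by (intro \<sigma>[symmetric] hom_graph_poly[OF G(1)]) (auto simp: graph_polys_def polys_over_def)
    then have "\<sigma> ` ?Z \<subseteq> ?Z" using \<sigma> hom_graph_zero[OF G(1)] by auto
    moreover have "finite ?Z" using p(2) by (rule poly_roots_finite)
    ultimately have "\<sigma> ` ?Z = ?Z" using \<open>inj \<sigma>\<close> by (metis endo_inj_surj inj_on_subset subset_UNIV)
    then show ?thesis using p(3) by blast
  qed
  ultimately have "field_aut \<sigma>" using add mult by (auto simp: field_aut_def bij_def)
  moreover have "\<sigma> x = y" using \<sigma> G0(3) G(2) by blast
  ultimately show ?thesis using that by blast
qed

text \<open>An irrational \<open>x\<close> is moved: over a maximal \<open>F\<close> avoiding it,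
  its minimal polynomial has a second root \<open>y\<close>, and the homomorphism over
  \<open>F\<close> taking \<open>x\<close> to \<open>y\<close> extends to an automorphism.\<close>

theorem fixed_by_all_auts_imp_Rats:
  fixes x :: "'a::{alg_closed_field, field_char_0}"
  assumes fixed: "\<And>\<sigma>. field_aut \<sigma> \<Longrightarrow> \<sigma> x = x"
  shows "x \<in> \<rat>"
proof (rule ccontr)
  assume "x \<notin> \<rat>"
  obtain F where F: "subfield_of F" "x \<notin> F" "\<forall>L. subfield_of L \<longrightarrow> F \<subseteq> L \<longrightarrow> L \<noteq> F \<longrightarrow> x \<in> L"
    by (rule exists_maximal_subfield_avoiding[OF \<open>x \<notin> \<rat>\<close>])
  have alg: "algebraic_over F t" for t using maximal_subfield_avoiding_algebraic[OF F] .
  obtain m where m: "m \<in> polys_over F" "lead_coeff m = 1" "poly m x = 0"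
    "\<forall>p\<in>polys_over F. p \<noteq> 0 \<longrightarrow> poly p x = 0 \<longrightarrow> degree m \<le> degree p"
    by (rule monic_minimal_poly[OF F(1) alg])
  \<comment> \<open>Separability in characteristic 0: otherwise \<open>m\<close> is a power of
    \<open>X - x\<close>, and its second highest coefficient, \<open>- x\<close> times the degree,
    puts \<open>x\<close> into \<open>F\<close>.\<close>
  have "\<exists>y. y \<noteq> x \<and> poly m y = 0"
  proof (rule ccontr)
    assume no: "\<not> ?thesis"
    obtain A where A: "size A = degree m" "m = smult (lead_coeff m) (\<Prod>a\<in>#A. [:-a, 1:])"
      using alg_closed_imp_factorization[of m] m(2) by (metis coeff_0 zero_neq_one)
    have "a = x" if "a \<in># A" for a
    proof (rule ccontr)
      assume "a \<noteq> x"
      moreover have "poly m a = 0"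
        using that by (subst A(2)) (auto simp: poly_prod_mset prod_mset_zero_iff image_iff)
      ultimately show False using no by blast
    qed
    then have "A = replicate_mset (degree m) x"
      using A(1) by (metis set_mset_subset_singletonD singleton_iff subsetI)
    then have mx: "m = [:-x, 1:] ^ degree m" using A(2) m(2) by simp
    have "degree m \<noteq> 0"
    proof
      assume "degree m = 0"
      then obtain c where "m = [:c:]" by (metis degree_eq_zeroE)
      then show False using m(2,3) by auto
    qed
    then obtain d where d: "degree m = Suc d" by (cases "degree m") auto
    have "coeff m d = of_nat (Suc d choose d) * (- x) ^ (Suc d - d)"
      unfolding mx[unfolded d] by (subst coeff_linear_poly_power) auto
    then have "x = (0 - coeff m d) / of_nat (Suc d)" by (simp add: field_simps del: of_nat_Suc)
    moreover have "of_nat k \<in> F" for k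
      by (induction k) (auto intro: subfield_zero subfield_one subfield_add F(1))
    ultimately have "x \<in> F"
      using m(1) subfield_zero[OF F(1)] subfield_divide[OF F(1)] subfield_diff[OF F(1)]
      unfolding polys_over_def by blast
    then show False using F(2) by simp
  qed
  then obtain y where y: "y \<noteq> x" "poly m y = 0" by blast
  have min: "degree m \<le> degree p" if "graph_polys (Id_on F) p p'" "poly p x = 0" "p \<noteq> 0" for p p'
    using that m(4) by (auto simp: graph_polys_def polys_over_def)
  have mm: "graph_polys (Id_on F) m m" using m(1) polys_over_iff[OF F(1)] by blast
  obtain G where G: "hom_graph G" "Id_on F \<subseteq> G" "(x, y) \<in> G"
    by (rule hom_graph_adjoin[OF hom_graph_Id_on[OF F(1)] mm m(2) y(2) min m(3)])
  obtain \<sigma> where "field_aut \<sigma>" "\<sigma> x = y"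
    by (rule hom_graph_extends_to_aut[OF F(1) alg G])
  then show False using fixed y(1) by auto
qed

section \<open>Galois descent for Hodge structures\<close>

subsection \<open>Semilinear action on vectors and matrices\<close>

context
  fixes \<sigma> :: "'a::field \<Rightarrow> 'a"
  assumes aut: "field_aut \<sigma>"
begin

lemma aut_add: "\<sigma> (a + b) = \<sigma> a + \<sigma> b"
  and aut_mult: "\<sigma> (a * b) = \<sigma> a * \<sigma> b"
  and aut_bij: "bij \<sigma>"
  using aut by (auto simp: field_aut_def)

lemma aut_0: "\<sigma> 0 = 0"
  using aut_add[of 0 0] unfolding add_0_left by (metis add_cancel_right_right)

lemma aut_eq_0_iff: "\<sigma> a = 0 \<longleftrightarrow> a = 0"
  using aut_0 aut_bij by (metis bij_pointE)

lemma aut_1: "\<sigma> 1 = 1"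
  using aut_mult[of 1 1] aut_eq_0_iff[of 1] by simp

lemma aut_diff: "\<sigma> (a - b) = \<sigma> a - \<sigma> b"
  using aut_add[of "a - b" b] by simp

lemma aut_sum: "\<sigma> (sum f I) = (\<Sum>i\<in>I. \<sigma> (f i))"
  by (induction I rule: infinite_finite_induct) (auto simp: aut_0 aut_add)

lemma aut_of_nat: "\<sigma> (of_nat k) = of_nat k"
  by (induction k) (auto simp: aut_0 aut_1 aut_add)

lemma aut_of_int: "\<sigma> (of_int k) = of_int k"
  by (cases k) (auto simp: aut_of_nat aut_diff aut_1 aut_add aut_0 diff_conv_add_uminus[symmetric] simp flip: diff_0)

end

lemma aut_of_rat:
  fixes \<sigma> :: "'a::field_char_0 \<Rightarrow> 'a"
  assumes "field_aut \<sigma>"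
  shows "\<sigma> (of_rat q) = of_rat q"
proof (cases q)
  case (Fract a b)
  have "of_int b * \<sigma> (of_rat q) = \<sigma> (of_int b * of_rat q)"
    by (simp add: aut_mult[OF assms] aut_of_int[OF assms])
  also have "of_int b * of_rat q = (of_int a :: 'a)"
    using Fract by (simp add: of_rat_rat)
  finally have "\<sigma> (of_rat q) = of_int a / of_int b"
    using Fract by (simp add: aut_of_int[OF assms] field_simps)
  then show ?thesis using Fract by (simp add: of_rat_rat)
qed

lemma field_aut_id: "field_aut id"
  by (simp add: field_aut_def)

lemma field_aut_comp: "field_aut \<sigma> \<Longrightarrow> field_aut \<tau> \<Longrightarrow> field_aut (\<sigma> \<circ> \<tau>)"
  by (auto simp: field_aut_def intro: bij_comp)

lemma field_aut_cnj: "field_aut cnj"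
  unfolding field_aut_def by (auto intro: bij_betw_byWitness[where f' = cnj])

lemma aut_inv:
  assumes "field_aut \<sigma>"
  shows "inv \<sigma> \<circ> \<sigma> = id" "\<sigma> \<circ> inv \<sigma> = id"
  using aut_bij[OF assms] by (auto simp: bij_is_inj surj_iff[symmetric] bij_is_surj)

lemma field_aut_inv:
  assumes "field_aut \<sigma>"
  shows "field_aut (inv \<sigma>)"
proof -
  have surj: "\<sigma> (inv \<sigma> a) = a" and inj: "inv \<sigma> (\<sigma> a) = a" for a
    using aut_inv[OF assms] by (metis comp_apply id_apply)+
  have "inv \<sigma> (a + b) = inv \<sigma> a + inv \<sigma> b" "inv \<sigma> (a * b) = inv \<sigma> a * inv \<sigma> b" for a b
    using inj[of "inv \<sigma> a + inv \<sigma> b"] inj[of "inv \<sigma> a * inv \<sigma> b"]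
    by (simp_all add: aut_add[OF assms] aut_mult[OF assms] surj)
  then show ?thesis using bij_imp_bij_inv[OF aut_bij[OF assms]] by (simp add: field_aut_def)
qed

lemma comp_inv_cancel:
  assumes "field_aut \<sigma>"
  shows "inv \<sigma> \<circ> (\<sigma> \<circ> \<tau>) = \<tau>" "\<sigma> \<circ> (inv \<sigma> \<circ> \<tau>) = \<tau>"
  using aut_inv[OF assms] by (simp_all add: o_assoc)

definition aut_vec :: "('a \<Rightarrow> 'a) \<Rightarrow> 'a ^ 'n \<Rightarrow> 'a ^ 'n" where
  "aut_vec \<sigma> v = (\<chi> i. \<sigma> (v $ i))"

definition aut_mat :: "('a \<Rightarrow> 'a) \<Rightarrow> 'a ^ 'n ^ 'm \<Rightarrow> 'a ^ 'n ^ 'm" where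
  "aut_mat \<sigma> A = (\<chi> i j. \<sigma> (A $ i $ j))"

lemma aut_vec_comp: "aut_vec (\<sigma> \<circ> \<tau>) v = aut_vec \<sigma> (aut_vec \<tau> v)"
  and aut_vec_id: "aut_vec id v = v"
  and aut_mat_comp: "aut_mat (\<sigma> \<circ> \<tau>) A = aut_mat \<sigma> (aut_mat \<tau> A)"
  and aut_mat_id: "aut_mat id A = A"
  and conj_vec_eq: "conj_vec w = aut_vec cnj w"
  by (simp_all add: aut_vec_def aut_mat_def conj_vec_def vec_eq_iff)

context
  fixes \<sigma> :: "'a::field \<Rightarrow> 'a"
  assumes aut: "field_aut \<sigma>"
begin

lemma aut_vec_add: "aut_vec \<sigma> (u + v) = aut_vec \<sigma> u + aut_vec \<sigma> v"
  and aut_vec_scale: "aut_vec \<sigma> (c *s v) = \<sigma> c *s aut_vec \<sigma> v"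
  by (simp_all add: aut_vec_def vec_eq_iff aut_add[OF aut] aut_mult[OF aut])

lemma aut_vec_eq_0_iff: "aut_vec \<sigma> v = 0 \<longleftrightarrow> v = 0"
  by (simp add: aut_vec_def vec_eq_iff aut_eq_0_iff[OF aut])

lemma aut_vec_0: "aut_vec \<sigma> 0 = 0"
  by (simp add: aut_vec_eq_0_iff)

lemma aut_vec_mult: "aut_vec \<sigma> (A *v v) = aut_mat \<sigma> A *v aut_vec \<sigma> v"
  by (simp add: aut_vec_def aut_mat_def vec_eq_iff matrix_vector_mult_def aut_sum[OF aut] aut_mult[OF aut])

lemma aut_mat_mult: "aut_mat \<sigma> (A ** B) = aut_mat \<sigma> A ** aut_mat \<sigma> B"
  by (simp add: aut_mat_def vec_eq_iff matrix_matrix_mult_def aut_sum[OF aut] aut_mult[OF aut])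

lemma aut_mat_1: "aut_mat \<sigma> (mat 1) = mat 1"
  by (simp add: aut_mat_def vec_eq_iff mat_def aut_0[OF aut] aut_1[OF aut])

lemma invertible_aut_mat: "invertible A \<Longrightarrow> invertible (aut_mat \<sigma> A)"
  unfolding invertible_def by (metis aut_mat_1 aut_mat_mult)

end

lemma aut_mat_complex_mat: "field_aut \<sigma> \<Longrightarrow> aut_mat \<sigma> (complex_mat X) = complex_mat X"
  by (simp add: aut_mat_def complex_mat_def aut_of_rat)

lemma aut_rat_polyfun:
  assumes "field_aut \<sigma>" "f \<in> rat_polyfuns"
  shows "f (aut_mat \<sigma> A) = \<sigma> (f A)"
  using assms(2)
  by induction (simp_all add: assms(1) aut_of_rat aut_add aut_mult aut_mat_def)

text \<open>Polynomials with rational coefficients commute with \<open>\<sigma>\<close>, so the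
  defining equations still hold after applying it.\<close>

lemma rat_algebraic_group_aut:
  assumes "field_aut \<sigma>" "rat_algebraic_group H" "A \<in> H"
  shows "aut_mat \<sigma> A \<in> H"
proof -
  obtain P where P: "P \<subseteq> rat_polyfuns" "H = {A. invertible A \<and> (\<forall>f\<in>P. f A = 0)}"
    using assms(2) unfolding rat_algebraic_group_def by blast
  have "f (aut_mat \<sigma> A) = 0" if "f \<in> P" for f
    using that P assms(3) aut_rat_polyfun[OF assms(1) subsetD[OF P(1) that], of A] aut_0[OF assms(1)]
    by auto
  then show ?thesis using assms(1,3) P(2) by (auto intro: invertible_aut_mat)
qed

subsection \<open>Descent of subspaces\<close>

text \<open>
  A nonzero vector of minimal support in a stable subspace, normalised to have some entry 1, is
  fixed by all automorphisms: the difference of two conjugates has smaller support.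
\<close>

lemma stable_subspace_has_rational_vector:
  fixes W :: "(complex ^ 'n::finite) set"
  assumes sub: "vec.subspace W" and stable: "\<And>\<sigma> w. field_aut \<sigma> \<Longrightarrow> w \<in> W \<Longrightarrow> aut_vec \<sigma> w \<in> W"
    and w: "w \<in> W" "w \<noteq> 0"
  obtains r where "complex_vec r \<in> W" "complex_vec r \<noteq> 0" "{i. complex_vec r $ i \<noteq> 0} \<subseteq> {i. w $ i \<noteq> 0}"
proof -
  define P where "P u \<longleftrightarrow> u \<in> W \<and> u \<noteq> 0 \<and> {i. u $ i \<noteq> 0} \<subseteq> {i. w $ i \<noteq> 0}" for u
  have "P w" using w by (simp add: P_def)
  then obtain u where u: "P u" and min: "\<And>v. P v \<Longrightarrow> card {i. u $ i \<noteq> 0} \<le> card {i. v $ i \<noteq> 0}"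
    using ex_has_least_nat[of P w "\<lambda>u. card {i. u $ i \<noteq> 0}"] by blast
  obtain i where i: "u $ i \<noteq> 0" using u by (auto simp: P_def vec_eq_iff)
  define u' where "u' = inverse (u $ i) *s u"
  have u'W: "u' \<in> W" using u sub by (auto simp: P_def u'_def intro: vec.subspace_scale)
  have "\<sigma> (u' $ j) = u' $ j" if \<sigma>: "field_aut \<sigma>" for \<sigma> j
  proof (rule ccontr)
    assume ne: "\<sigma> (u' $ j) \<noteq> u' $ j"
    let ?d = "aut_vec \<sigma> u' - u'"
    have "{i. ?d $ i \<noteq> 0} \<subseteq> {i. u $ i \<noteq> 0} - {i}"
      using i \<sigma> by (auto simp: aut_vec_def u'_def aut_0 aut_1)
    moreover from this have "P ?d"
      using ne u u'W stable[OF \<sigma>] sub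
      by (auto simp: P_def vec_eq_iff aut_vec_def intro!: vec.subspace_diff exI[of _ j])
    ultimately show False
      using min[of ?d] card_mono[of "{i. u $ i \<noteq> 0} - {i}" "{i. ?d $ i \<noteq> 0}"]
        card_Diff1_less[of "{i. u $ i \<noteq> 0}" i] i by simp
  qed
  then have "\<forall>j. \<exists>q. u' $ j = of_rat q"
    using fixed_by_all_auts_imp_Rats by (metis Rats_cases)
  then obtain q where q: "\<And>j. u' $ j = of_rat (q j)" by metis
  have r: "complex_vec (\<chi> j. q j) = u'" by (simp add: complex_vec_def vec_eq_iff q)
  show ?thesis
    by (rule that[of "\<chi> j. q j"]; unfold r) (use u u'W i in \<open>auto simp: P_def u'_def\<close>)
qed

text \<open>Induction on the size of the support: a rational vector of \<open>W\<close> supported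
  inside the support of \<open>w\<close> is scaled to cancel one entry of \<open>w\<close>, and the
  difference has smaller support.\<close>

lemma complex_subspace_rational_points:
  fixes W :: "(complex ^ 'n::finite) set"
  assumes sub: "vec.subspace W" and stable: "\<And>\<sigma> w. field_aut \<sigma> \<Longrightarrow> w \<in> W \<Longrightarrow> aut_vec \<sigma> w \<in> W"
  shows "complex_subspace {v. complex_vec v \<in> W} = W"
proof
  let ?U = "complex_subspace {v. complex_vec v \<in> W}"
  show "?U \<subseteq> W"
    unfolding complex_subspace_def by (rule vec.span_minimal) (auto simp: sub)
  have "w \<in> ?U" if "w \<in> W" for w
    using that
  proof (induction "card {i. w $ i \<noteq> 0}" arbitrary: w rule: less_induct)
    case less
    show ?case
    proof (cases "w = 0")
      case True
      then show ?thesis by (simp add: complex_subspace_def vec.span_zero)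
    next
      case False
      then obtain r where r: "complex_vec r \<in> W" "complex_vec r \<noteq> 0"
        "{i. complex_vec r $ i \<noteq> 0} \<subseteq> {i. w $ i \<noteq> 0}"
        using stable_subspace_has_rational_vector[OF sub stable less.prems] by blast
      then obtain i where i: "complex_vec r $ i \<noteq> 0" by (auto simp: vec_eq_iff)
      define c where "c = w $ i / complex_vec r $ i"
      define u where "u = w - c *s complex_vec r"
      have "{i. u $ i \<noteq> 0} \<subset> {i. w $ i \<noteq> 0}"
      proof
        show "{i. u $ i \<noteq> 0} \<subseteq> {i. w $ i \<noteq> 0}"
          using r(3) by (auto simp: u_def c_def)
        have "i \<in> {i. w $ i \<noteq> 0}" "i \<notin> {i. u $ i \<noteq> 0}"
          using r(3) i by (auto simp: u_def c_def)
        then show "{i. u $ i \<noteq> 0} \<noteq> {i. w $ i \<noteq> 0}" by blast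
      qed
      then have "u \<in> ?U"
        using r less.prems sub
        by (intro less.hyps psubset_card_mono) (auto simp: u_def intro: vec.subspace_diff vec.subspace_scale)
      moreover have "c *s complex_vec r \<in> ?U"
        using r(1) unfolding complex_subspace_def by (intro vec.span_scale vec.span_base) auto
      ultimately have "u + c *s complex_vec r \<in> ?U"
        unfolding complex_subspace_def by (rule vec.span_add)
      then show ?thesis by (simp add: u_def)
    qed
  qed
  then show "W \<subseteq> ?U" by blast
qed

lemma complex_subspace_UNIV: "complex_subspace UNIV = (UNIV :: (complex ^ 'n::finite) set)"
  using complex_subspace_rational_points[of "UNIV :: (complex ^ 'n) set"] by simp

subsection \<open>The complexified polarization\<close>

lemma complex_form_add_left: "complex_form Q (u + u') v = complex_form Q u v + complex_form Q u' v"
  and complex_form_add_right: "complex_form Q u (v + v') = complex_form Q u v + complex_form Q u v'"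
  and complex_form_scale_left: "complex_form Q (c *s u) v = c * complex_form Q u v"
  and complex_form_scale_right: "complex_form Q u (c *s v) = c * complex_form Q u v"
  by (simp_all add: complex_form_def algebra_simps sum.distrib sum_distrib_left)

lemma complex_form_zero: "complex_form Q 0 v = 0" "complex_form Q u 0 = 0"
  by (simp_all add: complex_form_def)

lemma aut_complex_form:
  "field_aut \<sigma> \<Longrightarrow> complex_form Q (aut_vec \<sigma> u) (aut_vec \<sigma> v) = \<sigma> (complex_form Q u v)"
  by (simp add: complex_form_def aut_vec_def aut_sum aut_mult aut_of_rat)

lemma complex_form_complex_vec:
  assumes "symplectic_form Q"
  shows "complex_form Q (complex_vec u) (complex_vec v) = of_rat (Q u v)"
proof -
  have lin: "Vector_Spaces.linear (*s) (*) (\<lambda>v. Q u v)" "Vector_Spaces.linear (*s) (*) (\<lambda>u. Q u v)" for u v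
    using assms by (auto simp: symplectic_form_def)
  note hom = Vector_Spaces.linear.axioms(3)[OF lin(1)] Vector_Spaces.linear.axioms(3)[OF lin(2)]
  have "Q u v = Q (\<Sum>i\<in>UNIV. u $ i *s axis i 1) (\<Sum>j\<in>UNIV. v $ j *s axis j 1)"
    by (simp add: basis_expansion)
  also have "\<dots> = (\<Sum>i\<in>UNIV. \<Sum>j\<in>UNIV. u $ i * v $ j * Q (axis i 1) (axis j 1))"
    by (simp add: module_hom.sum[OF hom(1)] module_hom.sum[OF hom(2)] module_hom.scale[OF hom(1)]
        module_hom.scale[OF hom(2)] sum_distrib_left mult_ac) (rule sum.swap)
  finally show ?thesis
    by (simp add: complex_form_def complex_vec_def of_rat_sum of_rat_mult)
qed

lemma complex_mat_mult_complex_vec: "complex_mat X *v complex_vec v = complex_vec (X *v v)"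
  by (simp add: complex_mat_def complex_vec_def matrix_vector_mult_def vec_eq_iff of_rat_sum of_rat_mult)

text \<open>The expression is linear in each slot and the rational vectors span, so skewness passes
  to complex vectors one slot at a time.\<close>

lemma complex_form_lie:
  fixes Q :: "rat ^ 'n::finite \<Rightarrow> rat ^ 'n \<Rightarrow> rat"
  assumes "symplectic_form Q" "X \<in> lie_rat Q"
  shows "complex_form Q (complex_mat X *v u) v + complex_form Q u (complex_mat X *v v) = 0"
proof -
  let ?F = "\<lambda>u v. complex_form Q (complex_mat X *v u) v + complex_form Q u (complex_mat X *v v)"
  have UNIV: "w \<in> vec.span (range complex_vec)" for w :: "complex ^ 'n"
    using complex_subspace_UNIV unfolding complex_subspace_def by blast
  note bil = complex_form_add_left complex_form_add_right complex_form_scale_left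
    complex_form_scale_right complex_form_zero matrix_vector_right_distrib vector_scalar_commute
    matrix_vector_mult_0_right
  have 1: "?F (complex_vec a) (complex_vec b) = 0" for a b
    using assms(2) unfolding lie_rat_def
    by (simp add: complex_mat_mult_complex_vec complex_form_complex_vec[OF assms(1)] flip: of_rat_add)
  have 2: "?F (complex_vec a) v = 0" for a v
    using UNIV[of v]
    by (induction rule: vec.span_induct) (use 1[of a] in \<open>auto simp: vec.subspace_def bil algebra_simps simp flip: distrib_left\<close>)
  show ?thesis
    using UNIV[of u]
    by (induction rule: vec.span_induct) (use 2 in \<open>auto simp: vec.subspace_def bil algebra_simps simp flip: distrib_left\<close>)
qed

section \<open>Irreducible CM Hodge structures\<close>

lemma span_singleton_eq_iff:
  fixes x y :: "'a::field ^ 'n"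
  assumes "x \<noteq> 0"
  shows "vec.span {x} = vec.span {y} \<longleftrightarrow> (\<exists>k. x = k *s y)"
proof
  assume "vec.span {x} = vec.span {y}"
  then have "x \<in> vec.span {y}" using vec.span_base[of x "{x}"] by simp
  then show "\<exists>k. x = k *s y" by (auto simp: vec.span_singleton)
next
  assume "\<exists>k. x = k *s y"
  then obtain k where k: "x = k *s y" by blast
  with assms have "y = inverse k *s x" by auto
  then have "x \<in> vec.span {y}" "y \<in> vec.span {x}"
    using k vec.span_scale[OF vec.span_base] by (metis singletonI)+
  then show "vec.span {x} = vec.span {y}"
    by (simp add: subset_antisym vec.span_minimal)
qed

lemma dim_1_imp_span_singleton:
  fixes S :: "('a::field ^ 'n) set"
  assumes "vec.subspace S" "vec.dim S = 1"
  obtains x where "x \<noteq> 0" "S = vec.span {x}"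
proof -
  obtain B where B: "B \<subseteq> S" "vec.independent B" "S \<subseteq> vec.span B" "card B = vec.dim S"
    using vec.basis_exists by blast
  then obtain x where x: "B = {x}" using assms(2) by (metis card_1_singletonE)
  have "S = vec.span {x}" using B assms(1) unfolding x by (metis subset_antisym vec.span_minimal)
  moreover have "x \<noteq> 0" using B(2) vec.dependent_zero x by blast
  ultimately show ?thesis using that by blast
qed

text \<open>One-dimensionality of the top component is recorded by a generator \<open>v0\<close>, so
  that Galois conjugates of a vector can be taken.\<close>

locale irreducible_CM =
  fixes Q :: "rat ^ 'n::finite \<Rightarrow> rat ^ 'n \<Rightarrow> rat" and n :: int and \<phi> :: "'n hodge_decomp"
    and v0 :: "complex ^ 'n"
  assumes sympl: "symplectic_form Q"
    and hodge: "hodge_structure n \<phi>"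
    and polarized: "polarized_by n Q \<phi>"
    and irreducible: "irreducible_hodge \<phi>"
    and CM: "is_CM \<phi>"
    and n_pos: "n > 0"
    and v0: "\<phi> n 0 = vec.span {v0}" "v0 \<noteq> 0"
begin

lemma subspace: "vec.subspace (\<phi> p q)"
  using hodge by (simp add: hodge_structure_def)

lemma trivial_outside: "\<not> (0 \<le> p \<and> 0 \<le> q \<and> p + q = n) \<Longrightarrow> \<phi> p q = {0}"
  using hodge by (simp add: hodge_structure_def)

lemma conj_mem: "v \<in> \<phi> p q \<Longrightarrow> conj_vec v \<in> \<phi> q p"
  using hodge unfolding hodge_structure_def by blast

lemma nonzero_range: "v \<in> \<phi> p q \<Longrightarrow> v \<noteq> 0 \<Longrightarrow> 0 \<le> p \<and> p \<le> n \<and> q = n - p"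
  using trivial_outside[of p q] by fastforce

lemma v0_mem: "v0 \<in> \<phi> n 0"
  by (simp add: v0(1) vec.span_base)

subsection \<open>Hodge components as eigenspaces\<close>

text \<open>For this \<open>z\<close> the scalars \<open>z\<^sup>p (cnj z)\<^sup>n\<^sup>-\<^sup>p\<close> with \<open>0 \<le> p \<le> n\<close> are distinct.\<close>

definition z :: complex where "z = cis (pi / (of_int n + 1))"

definition ev :: "int \<Rightarrow> complex" where "ev p = z powi p * cnj z powi (n - p)"

definition A :: "complex ^ 'n ^ 'n" where "A = hodge_rep \<phi> z"

text \<open>The angle of \<open>ev p\<close> is \<open>(2 * p - n) * pi / (n + 1)\<close>. Dividing
  by \<open>n + 1\<close> keeps it strictly between \<open>-pi\<close> and \<open>pi\<close>; with
  \<open>n\<close> instead, \<open>p = 0\<close> and \<open>p = n\<close> would give the same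
  value.\<close>

lemma ev_inj:
  assumes "ev p = ev p'" "0 \<le> p" "p \<le> n" "0 \<le> p'" "p' \<le> n"
  shows "p = p'"
proof -
  let ?a = "\<lambda>p. of_int (2 * p - n) * (pi / (of_int n + 1))"
  have ev: "ev p = cis (?a p)" for p
  proof -
    define x where "x = pi / (real_of_int n + 1)"
    have "ev p = cis (of_int p * x + of_int (n - p) * - x)"
      by (simp only: ev_def z_def cis_cnj cis_power_int cis_mult x_def)
    also have "of_int p * x + of_int (n - p) * - x = of_int (2 * p - n) * x"
      by (simp add: algebra_simps)
    finally show ?thesis unfolding x_def .
  qed
  have "?a p \<in> {-pi<..pi}" if "0 \<le> p" "p \<le> n" for p
  proof -
    have "real_of_int (2 * p - n) < of_int (n + 1)" "real_of_int (2 * p - n) > of_int (- (n + 1))"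
      using that by (simp_all only: of_int_less_iff)
    moreover have "real_of_int n + 1 > 0" using n_pos by simp
    ultimately have "of_int (2 * p - n) / (of_int n + 1) < (1::real)" "of_int (2 * p - n) / (of_int n + 1) > (-1::real)"
      by (simp_all add: field_simps)
    then have "of_int (2 * p - n) / (of_int n + 1) * pi < 1 * pi" "of_int (2 * p - n) / (of_int n + 1) * pi > -1 * pi"
      by (intro mult_strict_right_mono; simp)+
    then show ?thesis by simp
  qed
  then have "?a p = ?a p'" using assms ev Arg_cis by metis
  moreover have "pi / (real_of_int n + 1) \<noteq> 0" using n_pos by simp
  ultimately have "real_of_int (2 * p - n) = of_int (2 * p' - n)" using mult_cancel_right by blast
  then show ?thesis unfolding of_int_eq_iff by simp
qed

lemma A_eigen:
  assumes "v \<in> \<phi> p q"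
  shows "A *v v = ev p *s v"
proof (cases "v = 0")
  case False
  then have q: "q = n - p" using nonzero_range assms by blast
  have "\<forall>p q. \<forall>v\<in>\<phi> p q. A *v v = (z powi p * cnj z powi q) *s v"
    unfolding A_def hodge_rep_def by (rule theI'[OF hodge_rep_ex1[OF hodge]])
  then show ?thesis using assms unfolding ev_def q by blast
qed simp

lemma mem_unique: "v \<in> \<phi> p q \<Longrightarrow> v \<in> \<phi> p' q' \<Longrightarrow> v \<noteq> 0 \<Longrightarrow> p = p'"
  using A_eigen[of v p q] A_eigen[of v p' q'] nonzero_range[of v] ev_inj[of p p'] by auto

text \<open>Uniqueness of the Hodge decomposition compares \<open>A *v v\<close> with
  \<open>\<mu> *s v\<close> componentwise; the \<open>ev p\<close> are distinct, so a single
  component survives.\<close>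

lemma eigenvector_pure:
  assumes v: "A *v v = \<mu> *s v" "v \<noteq> 0"
  obtains p where "v \<in> \<phi> p (n - p)"
proof -
  obtain w where w: "\<And>p. w p \<in> \<phi> p (n - p)" "v = (\<Sum>p=0..n. w p)"
    using hodge unfolding hodge_structure_def by metis
  have "A *v v = (\<Sum>p=0..n. ev p *s w p)"
    unfolding w(2) using A_eigen[OF w(1)]
    by (simp add: vec.linear_sum[OF matrix_vector_mul_linear_gen])
  moreover have "\<mu> *s v = (\<Sum>p=0..n. \<mu> *s w p)"
    unfolding w(2) by (rule vec.scale_sum_right)
  ultimately have "(\<lambda>p. ev p *s w p) = (\<lambda>p. \<mu> *s w p)"
    using v(1) w(1) subspace by (intro hodge_decomp_unique[OF hodge]) (auto intro: vec.subspace_scale)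
  then have eq: "ev p *s w p = \<mu> *s w p" for p by meson
  have ev: "ev p = \<mu>" if "w p \<noteq> 0" for p
    using eq[of p] that by simp
  obtain p where p: "w p \<noteq> 0" using w(2) v(2) by (metis sum.neutral)
  have "w p' = 0" if "p' \<noteq> p" for p'
    using ev[of p'] ev[OF p] ev_inj[of p' p] nonzero_range[OF w(1)] p that by metis
  moreover have "p \<in> {0..n}" using nonzero_range[OF w(1) p] by simp
  ultimately have "v = w p"
    unfolding w(2) by (subst sum.remove[of _ p]) auto
  then show ?thesis using w(1) that by metis
qed

lemma eigenvector_n:
  assumes "A *v v = ev n *s v"
  shows "v \<in> \<phi> n 0"
proof (cases "v = 0")
  case True
  then show ?thesis using subspace vec.subspace_0 by blast
next
  case False
  then obtain p where p: "v \<in> \<phi> p (n - p)" using eigenvector_pure assms by blast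
  then have "ev p = ev n" using A_eigen[OF p] assms False by simp
  then have "p = n" using ev_inj nonzero_range[OF p False] n_pos by simp
  then show ?thesis using p by simp
qed

text \<open>The CM hypothesis enters here: the Mumford-Tate group contains the conjugates of
  \<open>A\<close> along with \<open>A\<close>, and it is commutative.\<close>

lemma A_conjugates_commute: "field_aut \<sigma> \<Longrightarrow> A ** aut_mat \<sigma> A = aut_mat \<sigma> A ** A"
proof -
  assume \<sigma>: "field_aut \<sigma>"
  have "z \<in> sphere 0 1" by (simp add: z_def)
  then have "A \<in> mumford_tate \<phi>"
    using mumford_tate_least(2)[OF hodge] unfolding A_def real_points_def by blast
  moreover from this have "aut_mat \<sigma> A \<in> mumford_tate \<phi>"
    using rat_algebraic_group_aut[OF \<sigma> mumford_tate_least(1)[OF hodge]] by blast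
  ultimately show ?thesis using CM by (simp add: is_CM_def)
qed

subsection \<open>The Galois orbit of the top line\<close>

definition orb :: "(complex \<Rightarrow> complex) \<Rightarrow> complex ^ 'n" where "orb \<tau> = aut_vec \<tau> v0"

text \<open>Lines are indexed by automorphisms, so that left and right translation can both be
  written as composition.\<close>

definition line :: "(complex \<Rightarrow> complex) \<Rightarrow> (complex ^ 'n) set" where "line \<tau> = vec.span {orb \<tau>}"

lemma orb_nonzero: "field_aut \<tau> \<Longrightarrow> orb \<tau> \<noteq> 0"
  by (simp add: orb_def aut_vec_eq_0_iff v0(2))

lemma orb_comp: "orb (\<sigma> \<circ> \<tau>) = aut_vec \<sigma> (orb \<tau>)"
  by (simp add: orb_def aut_vec_comp)

lemma orb_id: "orb id = v0"
  by (simp add: orb_def aut_vec_id)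

lemma line_eq_iff: "field_aut \<sigma> \<Longrightarrow> line \<sigma> = line \<tau> \<longleftrightarrow> (\<exists>k. orb \<sigma> = k *s orb \<tau>)"
  unfolding line_def by (rule span_singleton_eq_iff[OF orb_nonzero])

text \<open>
  The conjugate of \<open>A\<close> by \<open>inv \<tau>\<close> commutes with \<open>A\<close>, so it preserves the one-dimensional top eigenspace
  of \<open>A\<close>. Applying \<open>\<tau>\<close> shows that \<open>orb \<tau>\<close> is an eigenvector of \<open>A\<close>.
\<close>

lemma orb_pure:
  assumes \<tau>: "field_aut \<tau>"
  obtains p where "orb \<tau> \<in> \<phi> p (n - p)"
proof -
  define B where "B = aut_mat (inv \<tau>) A"
  have "A *v (B *v v0) = B *v (A *v v0)"
    unfolding B_def by (simp add: matrix_vector_mul_assoc A_conjugates_commute field_aut_inv \<tau>)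
  also have "\<dots> = ev n *s (B *v v0)"
    by (simp add: A_eigen[OF v0_mem] vector_scalar_commute)
  finally have "B *v v0 \<in> \<phi> n 0" by (rule eigenvector_n)
  then obtain k where k: "B *v v0 = k *s v0" unfolding v0(1) vec.span_singleton by blast
  have "aut_mat \<tau> B = A"
    unfolding B_def aut_mat_comp[symmetric] aut_inv[OF \<tau>] aut_mat_id ..
  then have "A *v orb \<tau> = \<tau> k *s orb \<tau>"
    using arg_cong[OF k, of "aut_vec \<tau>"] by (simp add: aut_vec_mult[OF \<tau>] aut_vec_scale[OF \<tau>] orb_def)
  then show ?thesis using eigenvector_pure orb_nonzero[OF \<tau>] that by blast
qed

text \<open>Galois stability makes the span rational and purity of its generators makes it a
  sub-Hodge structure, so irreducibility applies.\<close>

lemma span_orb: "vec.span (orb ` {\<tau>. field_aut \<tau>}) = UNIV" 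
proof -
  let ?W = "vec.span (orb ` {\<tau>. field_aut \<tau>})"
  have stable: "aut_vec \<sigma> w \<in> ?W" if \<sigma>: "field_aut \<sigma>" and w: "w \<in> ?W" for \<sigma> w
    using w
  proof (induction rule: vec.span_induct)
    case (step x)
    then show ?case
      using field_aut_comp[OF \<sigma>] by (auto simp: orb_comp[symmetric] intro!: vec.span_base)
  next
    case base
    then show ?case
      by (auto simp: vec.subspace_def aut_vec_0[OF \<sigma>] aut_vec_add[OF \<sigma>] aut_vec_scale[OF \<sigma>]
          intro: vec.span_zero vec.span_add vec.span_scale)
  qed
  let ?R = "{v. complex_vec v \<in> ?W}"
  have W: "complex_subspace ?R = ?W"
    by (rule complex_subspace_rational_points[OF vec.subspace_span stable])
  have "orb \<tau> \<in> vec.span (\<Union>p q. ?W \<inter> \<phi> p q)" if \<tau>: "field_aut \<tau>" for \<tau>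
  proof -
    obtain p where "orb \<tau> \<in> \<phi> p (n - p)" using orb_pure[OF \<tau>] .
    then show ?thesis using \<tau> by (blast intro: vec.span_base)
  qed
  then have "?W \<subseteq> vec.span (\<Union>p q. ?W \<inter> \<phi> p q)"
    by (intro vec.span_minimal vec.subspace_span) auto
  moreover have "vec.span (\<Union>p q. ?W \<inter> \<phi> p q) \<subseteq> ?W"
    by (intro vec.span_minimal vec.subspace_span) auto
  moreover have "vec.subspace ?R"
  proof -
    have "complex_vec 0 = (0 :: complex ^ 'n)" "complex_vec (u + v) = complex_vec u + complex_vec v"
      "complex_vec (c *s u) = of_rat c *s complex_vec u" for u v :: "rat ^ 'n" and c
      by (simp_all add: complex_vec_def vec_eq_iff of_rat_add of_rat_mult)
    then show ?thesis
      by (auto simp: vec.subspace_def intro: vec.span_zero vec.span_add vec.span_scale)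
  qed
  ultimately have "sub_hodge_structure \<phi> ?R"
    unfolding sub_hodge_structure_def W by blast
  then have "?R = {0} \<or> ?R = UNIV" using irreducible by (simp add: irreducible_hodge_def)
  moreover have "?R \<noteq> {0}"
  proof
    assume "?R = {0}"
    then have "?W = complex_subspace {0}" using W by simp
    also have "\<dots> = {0}"
      unfolding complex_subspace_def by (simp add: complex_vec_def vec.span_singleton zero_vec_def[symmetric])
    finally have "?W = {0}" .
    moreover have "orb id \<in> ?W" by (intro vec.span_base imageI CollectI field_aut_id)
    ultimately have "orb id \<in> {0}" by (rule subst)
    then show False using orb_nonzero[OF field_aut_id] by simp
  qed
  ultimately show ?thesis using W complex_subspace_UNIV by metis
qed

subsection \<open>The polarization on the orbit\<close>

abbreviation form where "form \<equiv> complex_form Q"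

text \<open>The first Hodge-Riemann relation, rephrased for the sesquilinear pairing
  \<open>form u (conj_vec v)\<close>: conjugation exchanges the two indices.\<close>

lemma form_orthogonal:
  assumes "u \<in> \<phi> p q" "v \<in> \<phi> p' q'" "p \<noteq> p'"
  shows "form u (conj_vec v) = 0"
proof (cases "u = 0 \<or> v = 0")
  case True
  then show ?thesis by (auto simp: complex_form_zero conj_vec_eq aut_vec_0[OF field_aut_cnj])
next
  case False
  then have "q = n - p" "q' = n - p'" using nonzero_range assms by blast+
  then show ?thesis
    using polarized[unfolded polarized_by_def, THEN conjunct1, rule_format, of p q q' p' u "conj_vec v"]
      conj_mem[OF assms(2)] assms(1,3) by simp
qed

lemma form_definite: "u \<in> \<phi> p q \<Longrightarrow> u \<noteq> 0 \<Longrightarrow> form u (conj_vec u) \<noteq> 0"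
  using polarized unfolding polarized_by_def by fastforce

text \<open>Left translation is the semilinear bijection \<open>aut_vec \<kappa>\<close>, so it acts
  on lines. This argument says nothing about right translation.\<close>

lemma line_comp_iff:
  assumes "field_aut \<kappa>" "field_aut \<sigma>" 
  shows "line (\<kappa> \<circ> \<sigma>) = line (\<kappa> \<circ> \<tau>) \<longleftrightarrow> line \<sigma> = line \<tau>"
proof -
  have imp: "line (\<kappa> \<circ> \<sigma>) = line (\<kappa> \<circ> \<tau>)" if "field_aut \<kappa>" "field_aut \<sigma>" "line \<sigma> = line \<tau>" for \<kappa> \<sigma> \<tau>
    using that by (auto simp: line_eq_iff field_aut_comp orb_comp aut_vec_scale)
  show ?thesis
    using imp[OF assms] imp[OF field_aut_inv[OF assms(1)] field_aut_comp[OF assms], of "\<kappa> \<circ> \<tau>"]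
    unfolding comp_inv_cancel[OF assms(1)] by blast
qed

lemma line_cong_mem:
  assumes "field_aut \<sigma>" "line \<sigma> = line \<tau>" "orb \<tau> \<in> \<phi> p q"
  shows "orb \<sigma> \<in> \<phi> p q"
  using assms vec.subspace_scale[OF subspace] by (auto simp: line_eq_iff)

text \<open>Undoing \<open>\<tau>\<close> leaves the pairing of a pure vector with
  \<open>conj_vec v0\<close>, which vanishes off \<open>\<phi> n 0\<close> and is definite on that
  line. Up to scalars, the vectors \<open>orb (\<tau> \<circ> cnj)\<close> are thus dual to the
  vectors \<open>orb \<tau>\<close>.\<close>

lemma form_orb:
  assumes \<sigma>: "field_aut \<sigma>" and \<tau>: "field_aut \<tau>"
  shows "form (orb \<sigma>) (orb (\<tau> \<circ> cnj)) \<noteq> 0 \<longleftrightarrow> line \<sigma> = line \<tau>"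
proof -
  define \<kappa> where "\<kappa> = inv \<tau> \<circ> \<sigma>"
  have \<kappa>: "field_aut \<kappa>" and \<sigma>_eq: "\<sigma> = \<tau> \<circ> \<kappa>"
    unfolding \<kappa>_def using \<sigma> \<tau> by (simp_all add: field_aut_comp field_aut_inv comp_inv_cancel)
  have "form (orb \<sigma>) (orb (\<tau> \<circ> cnj)) = \<tau> (form (orb \<kappa>) (conj_vec v0))"
    unfolding \<sigma>_eq orb_comp aut_complex_form[OF \<tau>] by (simp add: orb_def conj_vec_eq)
  then have "form (orb \<sigma>) (orb (\<tau> \<circ> cnj)) \<noteq> 0 \<longleftrightarrow> form (orb \<kappa>) (conj_vec v0) \<noteq> 0"
    by (simp add: aut_eq_0_iff[OF \<tau>])
  also have "\<dots> \<longleftrightarrow> line \<kappa> = line id"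
  proof -
    obtain p where p: "orb \<kappa> \<in> \<phi> p (n - p)" using orb_pure[OF \<kappa>] .
    show ?thesis
    proof (cases "p = n")
      case True
      then have "orb \<kappa> \<in> \<phi> n 0" using p by simp
      then obtain k where k: "orb \<kappa> = k *s v0" unfolding v0(1) vec.span_singleton by blast
      then have "k \<noteq> 0" using orb_nonzero[OF \<kappa>] by auto
      then show ?thesis
        using k form_definite[OF v0_mem v0(2)] \<kappa> by (auto simp: complex_form_scale_left line_eq_iff orb_id)
    next
      case False
      then have "form (orb \<kappa>) (conj_vec v0) = 0" by (rule form_orthogonal[OF p v0_mem])
      moreover have "line \<kappa> \<noteq> line id"
        using line_cong_mem[OF \<kappa>, of id n 0] v0_mem mem_unique[OF p _ orb_nonzero[OF \<kappa>]] False
        by (auto simp: orb_id)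
      ultimately show ?thesis by simp
    qed
  qed
  also have "\<dots> \<longleftrightarrow> line \<sigma> = line \<tau>"
    unfolding \<sigma>_eq using line_comp_iff[OF \<tau> \<kappa>, of id] by simp
  finally show ?thesis .
qed

text \<open>Definiteness makes \<open>orb \<sigma>\<close> pair nontrivially with its conjugate, and
  \<open>form_orb\<close> turns this into
  \<open>line \<sigma> = line (cnj \<circ> \<sigma> \<circ> cnj)\<close>. On lines, complex
  conjugation is central, as in a CM field.\<close>

lemma line_comp_cnj:
  assumes \<sigma>: "field_aut \<sigma>"
  shows "line (\<sigma> \<circ> cnj) = line (cnj \<circ> \<sigma>)"
proof -
  let ?\<tau> = "cnj \<circ> \<sigma> \<circ> cnj"
  have \<tau>: "field_aut ?\<tau>" by (intro field_aut_comp field_aut_cnj \<sigma>)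
  have cc: "cnj \<circ> cnj = id" by (auto simp: fun_eq_iff)
  obtain p where "orb \<sigma> \<in> \<phi> p (n - p)" using orb_pure[OF \<sigma>] .
  then have "form (orb \<sigma>) (conj_vec (orb \<sigma>)) \<noteq> 0"
    using form_definite orb_nonzero[OF \<sigma>] by blast
  moreover have "conj_vec (orb \<sigma>) = orb (?\<tau> \<circ> cnj)"
    by (simp add: conj_vec_eq orb_comp[symmetric] comp_assoc cc)
  ultimately have "line \<sigma> = line ?\<tau>" using form_orb[OF \<sigma> \<tau>] by simp
  then have "line (cnj \<circ> \<sigma>) = line (cnj \<circ> ?\<tau>)"
    using line_comp_iff[OF field_aut_cnj \<sigma>] by blast
  also have "cnj \<circ> ?\<tau> = \<sigma> \<circ> cnj" by (auto simp: fun_eq_iff)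
  finally show ?thesis ..
qed

text \<open>One representative per line gives a basis: the representatives span by
  \<open>span_orb\<close>, and pairing with \<open>orb (\<tau> \<circ> cnj)\<close> kills all of
  them except \<open>orb \<tau>\<close>.\<close>

lemma card_lines: "card (line ` {\<tau>. field_aut \<tau>}) = CARD('n)" "finite (line ` {\<tau>. field_aut \<tau>})"
proof -
  have "\<exists>T\<subseteq>{\<tau>. field_aut \<tau>}. inj_on line T \<and> line ` {\<tau>. field_aut \<tau>} = line ` T"
    by (rule iffD1[OF subset_image_inj order.refl])
  then obtain T where T: "T \<subseteq> {\<tau>. field_aut \<tau>}" "inj_on line T" "line ` {\<tau>. field_aut \<tau>} = line ` T"
    by (elim exE conjE)
  have inj: "inj_on orb T"
    using T(2) by (auto simp: inj_on_def line_def)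
  have "vec.independent (orb ` T)"
  proof
    assume "vec.dependent (orb ` T)"
    then obtain \<tau> where \<tau>: "\<tau> \<in> T" "orb \<tau> \<in> vec.span (orb ` T - {orb \<tau>})"
      unfolding vec.dependent_def by blast
    have aut: "field_aut \<sigma>" if "\<sigma> \<in> T" for \<sigma> using T(1) that by blast
    from \<tau>(2) have "form (orb \<tau>) (orb (\<tau> \<circ> cnj)) = 0"
    proof (induction rule: vec.span_induct)
      case (step x)
      then obtain \<sigma> where "\<sigma> \<in> T" "\<sigma> \<noteq> \<tau>" "x = orb \<sigma>" by blast
      then show ?case
        using form_orb[OF aut aut[OF \<tau>(1)], of \<sigma>] inj_on_eq_iff[OF T(2) \<open>\<sigma> \<in> T\<close> \<tau>(1)] by blast
    next
      case base
      then show ?case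
        by (simp add: vec.subspace_def complex_form_zero complex_form_add_left complex_form_scale_left)
    qed
    then show False using form_orb[OF aut aut, OF \<tau>(1) \<tau>(1)] by simp
  qed
  moreover have "vec.span (orb ` T) = vec.span (UNIV :: (complex ^ 'n) set)"
  proof -
    have "orb \<sigma> \<in> vec.span (orb ` T)" if \<sigma>: "field_aut \<sigma>" for \<sigma>
    proof -
      obtain \<tau> where "\<tau> \<in> T" "line \<sigma> = line \<tau>" using T(3) \<sigma> by blast
      moreover from this obtain k where "orb \<sigma> = k *s orb \<tau>" using line_eq_iff[OF \<sigma>] by blast
      ultimately show ?thesis by (simp add: vec.span_scale vec.span_base)
    qed
    then have "vec.span (orb ` {\<tau>. field_aut \<tau>}) \<subseteq> vec.span (orb ` T)"
      by (intro vec.span_minimal vec.subspace_span) auto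
    then show ?thesis using span_orb by auto
  qed
  ultimately have "vec.dim (UNIV :: (complex ^ 'n) set) = card (orb ` T)" "finite (orb ` T)"
    using vec.dim_eq_card vec.finiteI_independent by blast+
  then show "card (line ` {\<tau>. field_aut \<tau>}) = CARD('n)" "finite (line ` {\<tau>. field_aut \<tau>})"
    unfolding T(3) vec_dim_card card_image[OF T(2)] card_image[OF inj]
    using finite_imageD[OF _ inj] by auto
qed

text \<open>Otherwise every conjugate of \<open>v0\<close> would be orthogonal to \<open>u\<close>,
  hence so would the whole space, against definiteness.\<close>

lemma orb_in_component:
  assumes "u \<in> \<phi> p q" "u \<noteq> 0"
  obtains \<tau> where "field_aut \<tau>" "orb \<tau> \<in> \<phi> p q"
proof (rule ccontr)
  assume no: "\<not> thesis"
  note witness = that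
  have q: "q = n - p" using nonzero_range assms by blast
  have perp: "form w (conj_vec u) = 0" if w: "w \<in> vec.span (orb ` {\<tau>. field_aut \<tau>})" for w
    using w
  proof (induction rule: vec.span_induct)
    case (step x)
    then obtain \<tau> where \<tau>: "field_aut \<tau>" "x = orb \<tau>" by blast
    obtain p' where p': "orb \<tau> \<in> \<phi> p' (n - p')" using orb_pure[OF \<tau>(1)] .
    have "p' \<noteq> p"
    proof
      assume "p' = p"
      with p' q have "orb \<tau> \<in> \<phi> p q" by simp
      then show False using no witness \<tau>(1) by blast
    qed
    then show ?case unfolding \<tau>(2) by (rule form_orthogonal[OF p' assms(1)])
  next
    case base
    then show ?case
      by (simp add: vec.subspace_def complex_form_zero complex_form_add_left complex_form_scale_left)
  qed
  then show False using form_definite[OF assms] by (simp add: span_orb)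
qed

subsection \<open>Rational endomorphisms shifting the Hodge degree\<close>

text \<open>
  Right translation
  by \<open>\<rho>\<close> and by complex conjugation define a free action of the Klein four-group on the lines.
\<close>

lemma shift_imp_4_dvd:
  assumes Y: "Y \<in> lie_rat Q" and \<rho>: "field_aut \<rho>" "orb \<rho> \<in> \<phi> (n - 1) 1"
    and shift: "complex_mat Y *v v0 = a *s v0 + b *s orb \<rho>" "b \<noteq> 0" and n: "n > 2"
  shows "4 dvd CARD('n)"
proof -
  let ?\<Gamma> = "{\<tau>. field_aut \<tau>}"
  let ?c = cnj
  note comp = field_aut_comp
  note c = field_aut_cnj
  have cc: "?c \<circ> ?c = id" by (auto simp: fun_eq_iff)
  \<comment> \<open>The matrix of \<open>Y\<close> is rational, so applying \<open>\<tau>\<close> to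
    the relation for \<open>v0\<close> leaves it unchanged.\<close>
  have Y_orb: "complex_mat Y *v orb \<tau> = \<tau> a *s orb \<tau> + \<tau> b *s orb (\<tau> \<circ> \<rho>)" if \<tau>: "field_aut \<tau>" for \<tau>
    using arg_cong[OF shift(1), of "aut_vec \<tau>"]
    by (simp add: aut_vec_mult[OF \<tau>] aut_mat_complex_mat[OF \<tau>] aut_vec_add[OF \<tau>] aut_vec_scale[OF \<tau>]
        orb_comp) (simp add: orb_def)
  have deg: "orb id \<in> \<phi> n 0" "orb ?c \<in> \<phi> 0 n" "orb (\<rho> \<circ> ?c) \<in> \<phi> 1 (n - 1)"
  proof -
    show "orb id \<in> \<phi> n 0" by (simp add: orb_id v0_mem)
    show "orb ?c \<in> \<phi> 0 n" using conj_mem[OF v0_mem] by (simp add: orb_def conj_vec_eq)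
    have "orb (?c \<circ> \<rho>) \<in> \<phi> 1 (n - 1)" using conj_mem[OF \<rho>(2)] by (simp add: orb_comp conj_vec_eq)
    then show "orb (\<rho> \<circ> ?c) \<in> \<phi> 1 (n - 1)"
      using line_cong_mem[OF comp[OF \<rho>(1) c] line_comp_cnj[OF \<rho>(1)]] by blast
  qed
  have ne: "line \<sigma> \<noteq> line \<tau>" if "field_aut \<sigma>" "orb \<sigma> \<in> \<phi> p q" "orb \<tau> \<in> \<phi> p' q'" "p \<noteq> p'" for \<sigma> \<tau> p q p' q'
    using that line_cong_mem[of \<sigma> \<tau> p' q'] mem_unique orb_nonzero by blast
  \<comment> \<open>The four lines have first Hodge index \<open>n\<close>, \<open>n - 1\<close>,
    \<open>0\<close> and \<open>1\<close>, which differ pairwise since \<open>n > 2\<close>.\<close>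
  have distinct: "line id \<noteq> line \<rho>" "line id \<noteq> line ?c" "line id \<noteq> line (\<rho> \<circ> ?c)"
    "line \<rho> \<noteq> line ?c" "line \<rho> \<noteq> line (\<rho> \<circ> ?c)" "line ?c \<noteq> line (\<rho> \<circ> ?c)"
    using n by (auto intro!: ne[OF field_aut_id deg(1) \<rho>(2)] ne[OF field_aut_id deg(1,2)] ne[OF field_aut_id deg(1,3)]
        ne[OF \<rho>(1,2) deg(2)] ne[OF \<rho>(1,2) deg(3)] ne[OF c deg(2,3)] simp del: notI)
  have right_c: "line (\<sigma> \<circ> ?c) = line (\<tau> \<circ> ?c)" if "field_aut \<sigma>" "field_aut \<tau>" "line \<sigma> = line \<tau>" for \<sigma> \<tau>
    using that line_comp_cnj line_comp_iff[OF c] by metis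
  \<comment> \<open>If \<open>orb \<sigma> = k *s orb \<tau>\<close>, the two formulas for the image
    under \<open>Y\<close> agree up to \<open>k\<close>. Pairing with the dual vector of
    \<open>orb (\<sigma> \<circ> \<rho>)\<close> would isolate the nonzero term with
    \<open>\<sigma> b\<close>.\<close>
  have right_\<rho>: "line (\<sigma> \<circ> \<rho>) = line (\<tau> \<circ> \<rho>)" if \<sigma>: "field_aut \<sigma>" and \<tau>: "field_aut \<tau>" and eq: "line \<sigma> = line \<tau>" for \<sigma> \<tau>
  proof (rule ccontr)
    assume "\<not> ?thesis"
    moreover have "line \<sigma> \<noteq> line (\<sigma> \<circ> \<rho>)"
      using line_comp_iff[OF \<sigma> field_aut_id, of \<rho>] distinct(1) by simp
    ultimately have 0: "form (orb \<tau>) (orb (\<sigma> \<circ> \<rho> \<circ> ?c)) = 0" "form (orb \<sigma>) (orb (\<sigma> \<circ> \<rho> \<circ> ?c)) = 0"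
      "form (orb (\<tau> \<circ> \<rho>)) (orb (\<sigma> \<circ> \<rho> \<circ> ?c)) = 0"
      using form_orb[OF _ comp[OF \<sigma> \<rho>(1)]] \<sigma> \<tau> comp[OF \<tau> \<rho>(1)] eq by metis+
    obtain k where k: "orb \<sigma> = k *s orb \<tau>" using eq line_eq_iff[OF \<sigma>] by blast
    have "\<sigma> a *s orb \<sigma> + \<sigma> b *s orb (\<sigma> \<circ> \<rho>) = k *s (\<tau> a *s orb \<tau> + \<tau> b *s orb (\<tau> \<circ> \<rho>))"
      unfolding Y_orb[OF \<sigma>, symmetric] Y_orb[OF \<tau>, symmetric] unfolding k by (rule vector_scalar_commute)
    from arg_cong[OF this, of "\<lambda>v. form v (orb (\<sigma> \<circ> \<rho> \<circ> ?c))"]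
    have "\<sigma> b * form (orb (\<sigma> \<circ> \<rho>)) (orb (\<sigma> \<circ> \<rho> \<circ> ?c)) = 0"
      by (simp add: complex_form_add_left complex_form_scale_left 0)
    then show False
      using shift(2) form_orb[OF comp[OF \<sigma> \<rho>(1)] comp[OF \<sigma> \<rho>(1)]] aut_eq_0_iff[OF \<sigma>] by simp
  qed
  \<comment> \<open>Skewness of \<open>Y\<close> on \<open>v0\<close> and
    \<open>orb (\<rho> \<circ> cnj)\<close> balances the nonzero pairing of
    \<open>orb \<rho>\<close> with the latter against that of \<open>v0\<close> with
    \<open>orb (\<rho> \<circ> cnj \<circ> \<rho>)\<close>. So the second is nonzero too, and
    centrality of \<open>cnj\<close> removes the conjugations.\<close>
  have \<rho>\<rho>: "line (\<rho> \<circ> \<rho>) = line id"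
  proof -
    let ?v = "orb (\<rho> \<circ> ?c)"
    have \<rho>c: "field_aut (\<rho> \<circ> ?c)" by (intro comp c \<rho>)
    have 0: "form v0 ?v = 0"
      using form_orb[OF field_aut_id \<rho>(1)] distinct(1) by (simp add: orb_id)
    have "form (complex_mat Y *v v0) ?v + form v0 (complex_mat Y *v ?v) = 0"
      by (rule complex_form_lie[OF sympl Y])
    then have "b * form (orb \<rho>) ?v + (\<rho> \<circ> ?c) b * form v0 (orb (\<rho> \<circ> ?c \<circ> \<rho>)) = 0"
      unfolding shift(1) Y_orb[OF \<rho>c]
      by (simp add: complex_form_add_left complex_form_add_right complex_form_scale_left complex_form_scale_right 0)
    moreover have "b * form (orb \<rho>) ?v \<noteq> 0"
      using form_orb[OF \<rho>(1) \<rho>(1)] shift(2) by simp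
    ultimately have "form (orb id) (orb ((\<rho> \<circ> ?c \<circ> \<rho> \<circ> ?c) \<circ> ?c)) \<noteq> 0"
      by (auto simp: comp_assoc cc orb_id)
    then have "line id = line (\<rho> \<circ> ?c \<circ> \<rho> \<circ> ?c)"
      using form_orb[OF field_aut_id comp[OF comp[OF \<rho>c \<rho>(1)] c]] by blast
    also have "\<dots> = line (\<rho> \<circ> (?c \<circ> \<rho> \<circ> ?c))" by (simp add: comp_assoc)
    also have "\<dots> = line (\<rho> \<circ> \<rho>)"
    proof -
      have "line (?c \<circ> \<rho> \<circ> ?c) = line (?c \<circ> ?c \<circ> \<rho>)"
        using line_comp_iff[OF c comp[OF \<rho>(1) c]] line_comp_cnj[OF \<rho>(1)] by (simp add: comp_assoc)
      then show ?thesis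
        using line_comp_iff[OF \<rho>(1) comp[OF comp[OF c \<rho>(1)] c], of \<rho>] by (simp add: cc)
    qed
    finally show ?thesis ..
  qed
  \<comment> \<open>The orbit of \<open>line \<tau>\<close> under right translation by the
    four-group; these orbits will partition the lines into blocks of size 4.\<close>
  define cl where "cl \<tau> = {line \<tau>, line (\<tau> \<circ> \<rho>), line (\<tau> \<circ> ?c), line (\<tau> \<circ> (\<rho> \<circ> ?c))}" for \<tau>
  have left: "line (\<tau> \<circ> \<sigma>) = line (\<tau> \<circ> \<sigma>') \<longleftrightarrow> line \<sigma> = line \<sigma>'" if "field_aut \<tau>" "field_aut \<sigma>" for \<tau> \<sigma> \<sigma>'
    using line_comp_iff that by blast
  have card_cl: "card (cl \<tau>) = 4" if \<tau>: "field_aut \<tau>" for \<tau>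
    using left[OF \<tau> field_aut_id] left[OF \<tau> \<rho>(1)] left[OF \<tau> c] distinct
    unfolding cl_def by (simp add: card_insert_if)
  have cl_cong: "cl \<sigma> = cl \<tau>" if "field_aut \<sigma>" "field_aut \<tau>" "line \<sigma> = line \<tau>" for \<sigma> \<tau>
  proof -
    note \<rho>_eq = right_\<rho>[OF that]
    have "line (\<sigma> \<circ> (\<rho> \<circ> ?c)) = line (\<tau> \<circ> (\<rho> \<circ> ?c))"
      using right_c[OF comp[OF that(1) \<rho>(1)] comp[OF that(2) \<rho>(1)] \<rho>_eq] by (simp only: comp_assoc)
    then show ?thesis unfolding cl_def \<rho>_eq right_c[OF that] that(3) by (rule ssubst) (rule refl)
  qed
  have cl_\<rho>: "cl (\<tau> \<circ> \<rho>) = cl \<tau>" if \<tau>: "field_aut \<tau>" for \<tau>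
  proof -
    have 1: "line (\<tau> \<circ> \<rho> \<circ> \<rho>) = line \<tau>"
      using left[OF \<tau> comp[OF \<rho>(1) \<rho>(1)], of id] \<rho>\<rho> by (simp add: comp_assoc)
    then have "line (\<tau> \<circ> \<rho> \<circ> (\<rho> \<circ> ?c)) = line (\<tau> \<circ> ?c)"
      using right_c[OF comp[OF comp[OF \<tau> \<rho>(1)] \<rho>(1)] \<tau> 1] by (simp add: comp_assoc)
    then show ?thesis unfolding cl_def using 1 by (auto simp: comp_assoc)
  qed
  have cl_c: "cl (\<tau> \<circ> ?c) = cl \<tau>" if \<tau>: "field_aut \<tau>" for \<tau>
  proof -
    have 1: "line (\<tau> \<circ> ?c \<circ> \<rho>) = line (\<tau> \<circ> (\<rho> \<circ> ?c))"
      using left[OF \<tau> comp[OF c \<rho>(1)]] line_comp_cnj[OF \<rho>(1)] by (simp add: comp_assoc)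
    then have "line (\<tau> \<circ> ?c \<circ> (\<rho> \<circ> ?c)) = line (\<tau> \<circ> \<rho>)"
      using right_c[OF comp[OF comp[OF \<tau> c] \<rho>(1)] comp[OF \<tau> comp[OF \<rho>(1) c]] 1]
      by (simp add: comp_assoc cc)
    then show ?thesis unfolding cl_def using 1 by (auto simp: comp_assoc cc)
  qed
  have cl_mem: "cl \<kappa> = cl \<tau>" if \<kappa>: "field_aut \<kappa>" and \<tau>: "field_aut \<tau>" and "line \<kappa> \<in> cl \<tau>" for \<kappa> \<tau>
  proof -
    consider "line \<kappa> = line \<tau>" | "line \<kappa> = line (\<tau> \<circ> \<rho>)" | "line \<kappa> = line (\<tau> \<circ> ?c)" | "line \<kappa> = line (\<tau> \<circ> \<rho> \<circ> ?c)"
      using \<open>line \<kappa> \<in> cl \<tau>\<close> unfolding cl_def by (auto simp: comp_assoc)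
    then show ?thesis
      by cases (use cl_cong[OF \<kappa>] cl_\<rho> cl_c comp \<tau> \<rho>(1) c in metis)+
  qed
  have lines: "\<Union> (cl ` ?\<Gamma>) = line ` ?\<Gamma>"
    unfolding cl_def using comp \<rho>(1) c by auto
  have "4 dvd card (\<Union> (cl ` ?\<Gamma>))"
  proof (rule dvd_partition)
    show "finite (\<Union> (cl ` ?\<Gamma>))" unfolding lines by (rule card_lines)
    show "\<forall>c\<in>cl ` ?\<Gamma>. 4 dvd card c" using card_cl by simp
    show "\<forall>c1\<in>cl ` ?\<Gamma>. \<forall>c2\<in>cl ` ?\<Gamma>. c1 \<noteq> c2 \<longrightarrow> c1 \<inter> c2 = {}"
    proof (intro ballI impI, rule ccontr)
      fix c1 c2 assume c12: "c1 \<in> cl ` ?\<Gamma>" "c2 \<in> cl ` ?\<Gamma>" "c1 \<noteq> c2" "c1 \<inter> c2 \<noteq> {}"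
      then obtain s where s: "s \<in> c1" "s \<in> c2" by blast
      then have "s \<in> line ` ?\<Gamma>" using c12(1) lines by blast
      then obtain \<kappa> where "field_aut \<kappa>" "s = line \<kappa>" by blast
      then show False using s c12 cl_mem by blast
    qed
  qed
  then show ?thesis unfolding lines card_lines .
qed

end

section \<open>Vanishing of the components of degree 1 and -1\<close>

theorem theorem4p7:
  fixes Q :: "rat ^ 'n \<Rightarrow> rat ^ 'n \<Rightarrow> rat"
    and n :: int
    and h :: "int \<Rightarrow> int \<Rightarrow> nat"
    and \<phi> :: "'n::finite hodge_decomp"
  assumes "symplectic_form Q"
    and "odd n" and "n > 1"
    and "h n 0 = 1" and "h (n - 1) 1 = 1"
    and "\<not> 4 dvd vec.dim (UNIV :: (rat ^ 'n) set)"
    and "\<phi> \<in> period_domain n Q h"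
    and "irreducible_hodge \<phi>"
    and "is_CM \<phi>"
  shows "(lie_hodge Q \<phi> 1 + lie_hodge Q \<phi> 0 + lie_hodge Q \<phi> (-1)) \<inter> complex_mat ` lie_rat Q
           \<subseteq> lie_hodge Q \<phi> 0"
proof
  have hodge: "hodge_structure n \<phi>" "polarized_by n Q \<phi>" and dim: "\<And>p q. vec.dim (\<phi> p q) = h p q"
    using assms(7) by (auto simp: period_domain_def)
  have sub: "vec.subspace (\<phi> p q)" for p q using hodge by (simp add: hodge_structure_def)
  obtain v0 where gen: "v0 \<noteq> 0" "\<phi> n 0 = vec.span {v0}"
    using dim_1_imp_span_singleton[OF sub, of n 0] dim assms(4) by auto
  interpret irreducible_CM Q n \<phi> v0
    using assms hodge gen by unfold_locales auto
  \<comment> \<open>Oddness excludes weight 2, where the components of index \<open>n - 1\<close>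
    and \<open>1\<close> coincide.\<close>
  have n: "n > 2" using assms(2,3) by presburger
  fix X assume "X \<in> (lie_hodge Q \<phi> 1 + lie_hodge Q \<phi> 0 + lie_hodge Q \<phi> (-1)) \<inter> complex_mat ` lie_rat Q"
  then obtain Y X1 X0 Xm where X: "X = X1 + X0 + Xm" "X = complex_mat Y" "Y \<in> lie_rat Q"
    and lie: "X1 \<in> lie_hodge Q \<phi> 1" "X0 \<in> lie_hodge Q \<phi> 0" "Xm \<in> lie_hodge Q \<phi> (-1)"
    unfolding set_plus_def by blast
  have shifts: "Z *v u \<in> \<phi> (p + l) (q - l)" if "Z \<in> lie_hodge Q \<phi> l" "u \<in> \<phi> p q" for Z l u p q
    using that unfolding lie_hodge_def by blast
  have mem: "X1 *v u \<in> \<phi> (p + 1) (q - 1)" "X0 *v u \<in> \<phi> p q" "Xm *v u \<in> \<phi> (p - 1) (q + 1)"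
    if "u \<in> \<phi> p q" for u p q
    using shifts[OF lie(1) that] shifts[OF lie(2) that] shifts[OF lie(3) that] by simp_all
  have X_eq: "X *v u = X1 *v u + X0 *v u + Xm *v u" for u
    by (simp add: X(1) matrix_vector_mult_add_rdistrib)
  have top: "X1 *v v0 = 0"
    using mem(1)[OF v0_mem] trivial_outside[of "n + 1" "-1"] by simp
  obtain a where a: "X0 *v v0 = a *s v0"
    using mem(2)[OF v0_mem] unfolding gen(2) vec.span_singleton by blast
  have Xm_mem: "Xm *v v0 \<in> \<phi> (n - 1) 1" using mem(3)[OF v0_mem] by simp
  \<comment> \<open>A nonzero image would span the one-dimensional \<open>\<phi> (n - 1) 1\<close>,
    which also contains some conjugate \<open>orb \<rho>\<close>. This puts \<open>Y\<close> in the
    situation of \<open>shift_imp_4_dvd\<close>.\<close>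
  have bottom: "Xm *v v0 = 0"
  proof (rule ccontr)
    assume ne: "Xm *v v0 \<noteq> 0"
    obtain \<rho> where \<rho>: "field_aut \<rho>" "orb \<rho> \<in> \<phi> (n - 1) 1" using orb_in_component[OF Xm_mem ne] .
    obtain w where w: "w \<noteq> 0" "\<phi> (n - 1) 1 = vec.span {w}"
      using dim_1_imp_span_singleton[OF sub, of "n - 1" 1] dim assms(5) by auto
    obtain k l where k: "orb \<rho> = k *s w" and l: "Xm *v v0 = l *s w"
      using \<rho>(2) Xm_mem unfolding w(2) vec.span_singleton by blast
    have "k \<noteq> 0" "l \<noteq> 0" using k l ne orb_nonzero[OF \<rho>(1)] by auto
    then have "complex_mat Y *v v0 = a *s v0 + (l / k) *s orb \<rho>"
      using X_eq[of v0] unfolding X(2) top a k l by simp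
    then have "4 dvd CARD('n)"
      using shift_imp_4_dvd[OF X(3) \<rho>] n \<open>k \<noteq> 0\<close> \<open>l \<noteq> 0\<close> by auto
    then show False using assms(6) unfolding vec_dim_card by blast
  qed
  \<comment> \<open>Now \<open>v0\<close> is an eigenvector of the rational \<open>X\<close>, hence
    so is each conjugate. Subtracting the eigenvalue leaves a vanishing sum of three vectors of
    different Hodge types; pairing with the conjugate of one of them removes the other two, and
    definiteness kills it.\<close>
  have zero: "X1 *v orb \<tau> = 0 \<and> Xm *v orb \<tau> = 0" if \<tau>: "field_aut \<tau>" for \<tau>
  proof -
    obtain p where p: "orb \<tau> \<in> \<phi> p (n - p)" using orb_pure[OF \<tau>] .
    have "X *v v0 = a *s v0" by (simp add: X_eq top a bottom)
    from arg_cong[OF this, of "aut_vec \<tau>"] have "X *v orb \<tau> = \<tau> a *s orb \<tau>"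
      by (simp add: X(2) aut_vec_mult[OF \<tau>] aut_mat_complex_mat[OF \<tau>] aut_vec_scale[OF \<tau>] orb_def)
    then have sum: "X1 *v orb \<tau> + (X0 *v orb \<tau> - \<tau> a *s orb \<tau>) + Xm *v orb \<tau> = 0"
      using X_eq[of "orb \<tau>"] by (simp add: algebra_simps)
    note m = mem(1)[OF p] vec.subspace_diff[OF sub mem(2)[OF p] vec.subspace_scale[OF sub p, of "\<tau> a"]] mem(3)[OF p]
    from arg_cong[OF sum, of "\<lambda>v. form v (conj_vec (X1 *v orb \<tau>))"]
    have "form (X1 *v orb \<tau>) (conj_vec (X1 *v orb \<tau>)) = 0"
      using form_orthogonal[OF m(2) m(1)] form_orthogonal[OF m(3) m(1)]
      by (simp add: complex_form_add_left complex_form_zero)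
    moreover from arg_cong[OF sum, of "\<lambda>v. form v (conj_vec (Xm *v orb \<tau>))"]
    have "form (Xm *v orb \<tau>) (conj_vec (Xm *v orb \<tau>)) = 0"
      using form_orthogonal[OF m(2) m(3)] form_orthogonal[OF m(1) m(3)]
      by (simp add: complex_form_add_left complex_form_zero)
    ultimately show ?thesis using form_definite m(1,3) by blast
  qed
  have "X1 *v w = 0 \<and> Xm *v w = 0" if "w \<in> vec.span (orb ` {\<tau>. field_aut \<tau>})" for w
    using that
    by (induction rule: vec.span_induct)
      (use zero in \<open>auto simp: vec.subspace_def matrix_vector_right_distrib vector_scalar_commute\<close>)
  then have "X *v w = X0 *v w" for w by (simp add: X_eq span_orb)
  then show "X \<in> lie_hodge Q \<phi> 0" using lie(2) matrix_eq[of X X0] by simp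
qed

end
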